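(* Consider a $(K,L,M_a,M_p,N)$-CW-MAP coded caching setting such that $\gamma_a=\frac{KM_a}{N}$ and $\gamma_p=\frac{KM_p}{N}$ are non-negative integers and $$N\left(1-\frac1K\right)\le M_aL+M_p\le N .$$ Let $R_{M_a,M_p}$ be the worst-case rate attained by the CW-MAP scheme described in the context. Then this scheme is optimal, i.e. $R_{M_a,M_p}=R^{*}_{M_a,M_p}$, where $R^{*}_{M_a,M_p}$ is the optimal worst-case rate (over all schemes, with coded or uncoded placement).
   Context: **Notation.** $[K]=\{1,\dots,K\}$; $\binom{A}{t}$ is the set of $t$-element subsets of a set $A$; $\langle a\rangle_K$ is the representative of the integer $a$ modulo $K$ in $\{1,\dots,K\}$, applied elementwise to sets; $\oplus$ is bitwise XOR. **The $(K,L,M_a,M_p,N)$-CW-MAP (cyclic wrap-around multi-access plus private) coded caching setting.** $K,L,N$ are positive integers with $1\le L\le K\le N$, and $M_a,M_p\in[0,N]$ are real. A server holds $N$ files $W_1,\dots,W_N$, each of $B$ bits. There are $K$ access caches, each of capacity $M_aB$ bits, and $K$ users, each with a private cache of capacity $M_pB$ bits. User $u\in[K]$ can read, at no cost, its own private cache and the $L$ access caches with indices $\langle u\rangle_K,\dots,\langle u+L-1\rangle_K$. A coded caching scheme with file size $B$ consists of: a placement, i.e. access cache contents $\mathcal Z^a_k$ and private cache contents $\mathcal Z^p_u$ that are functions of the files of at most $M_aB$ and $M_pB$ bits respectively, chosen without knowledge of the demands; and a delivery, i.e. for each demand vector $\mathbf d=(d_1,\dots,d_K)\in[N]^K$ a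 broadcast message $X_{\mathbf d}$ of $R_{\mathbf d}B$ bits, a function of the files, received by all users, such that each user $u$ can recover $W_{d_u}$ from $X_{\mathbf d}$, $\mathcal Z^p_u$ and the access caches it reads. Its worst-case rate is $R=\max_{\mathbf d}R_{\mathbf d}$. The triple $(M_a,M_p,R)$ is achievable if, for some large enough $B$, there is a scheme with worst-case rate $R$; and $R^{*}_{M_a,M_p}=\inf\{R:(M_a,M_p,R)\text{ is achievable}\}$. **The CW-MAP scheme** (for integers $\gamma_a=KM_a/N\ge0$, $\gamma_p=KM_p/N\ge0$ with $\gamma_aL+\gamma_p\le K$; $B$ a multiple of the subpacketization $F$, the number of mini-subfiles each file is split into). *Placement.* Each file is split into $K$ equal subfiles $W_n=\{W_{n,i}:i\in[K]\}$, and access cache $k$ stores $\mathcal Z^a_k=\{W_{n,\langle k+(j-1)L\rangle_K}:j\in[\gamma_a],\,n\in[N]\}$. The users that can read $W_{n,i}$ from their access caches are exactly those in $S=\langle\{i-\gamma_aL+1,\dots,i\}\rangle_K$, and $W_{n,i}$ is re-indexed as $W_{n,S}$. Any set of the form $\langle\{j-\gamma_aL+1,\dots,j\}\rangle_K$, $j\in[K]$ (of size $\gamma_aL$) is called a subfile-index set. Each subfile is split into $\binom{K-\gamma_aL}{\gamma_p}$ equal mini-subfiles $W_{n,S}=\{W_{n,S,T}:T\in\binom{[K]\setminus S}{\gamma_p}\}$, and user $u$'s private cache stores $\mathcal Z^p_u=\{W_{n,S,T}:S\text{ a subfile-index set},\,u\notin S,\,T\in\binom{[K]\setminus S}{\gamma_p},\,u\in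 T,\,n\in[N]\}$. The subpacketization is $F=K\binom{K-\gamma_aL}{\gamma_p}$. If $\gamma_a=0$, the only subfile-index set is $\emptyset$; the file is then not split into subfiles ($W_{n,\emptyset}=W_n$) and $F=\binom{K}{\gamma_p}$. (If $\gamma_aL=K$, every user reads all subfiles from its access caches and nothing is transmitted.) *Delivery.* For a triple $(u,S,T)$ with $S$ a subfile-index set, $u\notin S$, $T\in\binom{[K]\setminus(S\cup\{u\})}{\gamma_p}$, let $I=\{u\}\cup S\cup T$ with elements listed in increasing order, $I(i)$ its $i$-th element, and $I(P)=\{I(i):i\in P\}$ for a set $P$ of positions. Let $P^I_u,P^I_S,P^I_T$ be the sets of positions in $I$ of $u$, of the elements of $S$, and of the elements of $T$; for an integer $j$, $P+j=\{\langle p+j\rangle_{|I|}:p\in P\}$, where $\langle\cdot\rangle_{|I|}$ takes values in $\{1,\dots,|I|\}$. A singleton is identified with its element. For each $u\in[K]$ let $D_u$ be the set of all pairs $(S,T)$ such that $S$ is a subfile-index set, $u\notin S$, and $T\in\binom{[K]\setminus(S\cup\{u\})}{\gamma_p}$. For $u=1,\dots,K$, while $D_u\ne\emptyset$: select any $(S,T)\in D_u$ and transmit one coded message $X'$ (of the size of one mini-subfile) as follows. 1. (Special Case 1) If $S$ is the only subfile-index set contained in $I$: $X'=W_{d_u,S,T}\oplus\bigoplus_{t\in T}W_{d_t,S,(\{u\}\cup T)\setminus\{t\}}$. 2. (Special Case 2) If $I$ contains exactly two subfile-index sets, namely $S$ and $\{u\}\cup T$: let $j\in[2\gamma_aL-1]$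 with $I(P^I_S+j)=\{u\}\cup T$, and put $u'=I(P^I_u+j)$, $S'=I(P^I_S+j)$, $T'=I(P^I_T+j)$; then $X'=W_{d_u,S,T}\oplus\bigoplus_{t\in T}W_{d_t,S,(\{u\}\cup T)\setminus\{t\}}\oplus W_{d_{u'},S',T'}\oplus\bigoplus_{i\in T'}W_{d_i,S',(T'\cup\{u'\})\setminus\{i\}}$. 3. (General Case) Otherwise: $X'$ is the XOR of $W_{d_u,S,T}$ and all $W_{d_{I(P^I_u+i)},\,I(P^I_S+i),\,I(P^I_T+i)}$ with $i\in[\gamma_aL+\gamma_p]$ such that $I(P^I_S+i)$ is a subfile-index set. After each transmission, for every term $W_{d_{\hat u},\hat S,\hat T}$ appearing in $X'$, remove $(\hat S,\hat T)$ from $D_{\hat u}$. The worst-case rate $R_{M_a,M_p}$ attained by the scheme is the total number of transmissions divided by $F$. *)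

theory Defs
  imports Complex_Main "HOL-Library.FuncSet" "HOL-Library.Z2"
begin

definition cyc :: "nat \<Rightarrow> int \<Rightarrow> nat" where
  "cyc K a = nat ((a - 1) mod int K) + 1"

definition accessible :: "nat \<Rightarrow> nat \<Rightarrow> nat \<Rightarrow> nat set" where
  "accessible K L u = (\<lambda>l. cyc K (int u + int l)) ` {0..<L}"

definition libraries :: "nat \<Rightarrow> nat \<Rightarrow> (nat \<Rightarrow> bit list) set" where
  "libraries N B = {1..N} \<rightarrow>\<^sub>E {w. length w = B}"

definition demands :: "nat \<Rightarrow> nat \<Rightarrow> (nat \<Rightarrow> nat) set" where
  "demands K N = {1..K} \<rightarrow>\<^sub>E {1..N}"

text \<open>
  The three size fields are the lengths in bits of the cache contents and of the broadcast.
  They do not depend on the file contents, so that no information is conveyed by the length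
  of a bit string.
\<close>

record coded_scheme =
  acc :: "nat \<Rightarrow> (nat \<Rightarrow> bit list) \<Rightarrow> bit list"
  priv :: "nat \<Rightarrow> (nat \<Rightarrow> bit list) \<Rightarrow> bit list"
  bcast :: "(nat \<Rightarrow> nat) \<Rightarrow> (nat \<Rightarrow> bit list) \<Rightarrow> bit list"
  acc_bits :: "nat \<Rightarrow> nat"
  priv_bits :: "nat \<Rightarrow> nat"
  bcast_bits :: "(nat \<Rightarrow> nat) \<Rightarrow> nat"

definition caching_scheme ::
    "nat \<Rightarrow> nat \<Rightarrow> nat \<Rightarrow> real \<Rightarrow> real \<Rightarrow> nat \<Rightarrow> coded_scheme \<Rightarrow> bool" where
  "caching_scheme K L N Ma Mp B s \<longleftrightarrow>
     (\<forall>k\<in>{1..K}. real (acc_bits s k) \<le> Ma * real B \<and>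
        (\<forall>W\<in>libraries N B. length (acc s k W) = acc_bits s k)) \<and>
     (\<forall>u\<in>{1..K}. real (priv_bits s u) \<le> Mp * real B \<and>
        (\<forall>W\<in>libraries N B. length (priv s u W) = priv_bits s u)) \<and>
     (\<forall>d\<in>demands K N. \<forall>W\<in>libraries N B. length (bcast s d W) = bcast_bits s d) \<and>
     (\<forall>d\<in>demands K N. \<forall>u\<in>{1..K}. \<exists>decode. \<forall>W\<in>libraries N B.
        decode (bcast s d W) (priv s u W) (\<lambda>k\<in>accessible K L u. acc s k W) = W (d u))"

definition worst_rate :: "nat \<Rightarrow> nat \<Rightarrow> nat \<Rightarrow> coded_scheme \<Rightarrow> real" where
  "worst_rate K N B s = (MAX d\<in>demands K N. real (bcast_bits s d) / real B)"

text \<open>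
  Concatenating copies of a scheme for file size \<open>B\<close> gives a scheme of the same rate for every
  multiple of \<open>B\<close>, so asking for some positive \<open>B\<close> is the same as asking for arbitrarily large ones.
\<close>

definition achievable :: "nat \<Rightarrow> nat \<Rightarrow> nat \<Rightarrow> real \<Rightarrow> real \<Rightarrow> real \<Rightarrow> bool" where
  "achievable K L N Ma Mp R \<longleftrightarrow>
     (\<exists>B>0. \<exists>s. caching_scheme K L N Ma Mp B s \<and> worst_rate K N B s = R)"

definition opt_rate :: "nat \<Rightarrow> nat \<Rightarrow> nat \<Rightarrow> real \<Rightarrow> real \<Rightarrow> real" where
  "opt_rate K L N Ma Mp = Inf {R. achievable K L N Ma Mp R}"

text \<open>
  In the definition of the CW-MAP scheme, \<open>ga\<close> and \<open>gp\<close> stand for \<open>\<gamma>\<^sub>a\<close> and \<open>\<gamma>\<^sub>p\<close>, and \<open>m\<close>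
  stands for \<open>\<gamma>\<^sub>aL\<close>, the size of the subfile-index sets.
\<close>

definition index_set :: "nat \<Rightarrow> nat \<Rightarrow> nat \<Rightarrow> nat set" where
  "index_set K m i = cyc K ` {int i - int m + 1..int i}"

text \<open>
  If \<open>m = 0\<close> the file is not split into subfiles; the dummy number \<open>0\<close> then denotes the whole file.
\<close>

definition subfiles :: "nat \<Rightarrow> nat \<Rightarrow> nat set" where
  "subfiles K m = (if m = 0 then {0} else {1..K})"

definition index_sets :: "nat \<Rightarrow> nat \<Rightarrow> nat set set" where
  "index_sets K m = index_set K m ` subfiles K m"

text \<open>
  For \<open>m < K\<close> a subfile-index set belongs to exactly one subfile. For \<open>m = K\<close> all subfiles share the
  index set \<open>{1..K}\<close>, which is why mini-subfiles are labelled by the number of the subfile rather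
  than by its index set; nothing is transmitted in that case, and \<open>subfile_of\<close> is not used.
\<close>

definition subfile_of :: "nat \<Rightarrow> nat \<Rightarrow> nat set \<Rightarrow> nat" where
  "subfile_of K m S = (THE i. i \<in> subfiles K m \<and> index_set K m i = S)"

definition mini_labels :: "nat \<Rightarrow> nat \<Rightarrow> nat \<Rightarrow> (nat \<times> nat set) set" where
  "mini_labels K m gp =
     (SIGMA i:subfiles K m. {T. T \<subseteq> {1..K} - index_set K m i \<and> card T = gp})"

definition subpacketization :: "nat \<Rightarrow> nat \<Rightarrow> nat \<Rightarrow> nat" where
  "subpacketization K m gp = (if m = 0 then K choose gp else K * ((K - m) choose gp))"

text \<open>
  A file is cut into blocks of \<open>b\<close> bits, and \<open>blk\<close>, a bijection from the labels to the block
  numbers, says which block is which mini-subfile.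
\<close>

definition mini :: "nat \<Rightarrow> (nat \<times> nat set \<Rightarrow> nat) \<Rightarrow> bit list \<Rightarrow> nat \<times> nat set \<Rightarrow> bit list" where
  "mini b blk w l = take b (drop (blk l * b) w)"

definition acc_labels :: "nat \<Rightarrow> nat \<Rightarrow> nat \<Rightarrow> nat \<Rightarrow> nat \<Rightarrow> (nat \<times> nat set) set" where
  "acc_labels K L ga gp k =
     {(i, T) \<in> mini_labels K (ga * L) gp. \<exists>j\<in>{1..ga}. i = cyc K (int k + (int j - 1) * int L)}"

definition priv_labels :: "nat \<Rightarrow> nat \<Rightarrow> nat \<Rightarrow> nat \<Rightarrow> (nat \<times> nat set) set" where
  "priv_labels K m gp u = {(i, T) \<in> mini_labels K m gp. u \<notin> index_set K m i \<and> u \<in> T}"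

definition store ::
    "nat \<Rightarrow> nat \<Rightarrow> (nat \<times> nat set \<Rightarrow> nat) \<Rightarrow> (nat \<times> nat set) set \<Rightarrow> (nat \<Rightarrow> bit list) \<Rightarrow> bit list"
  where
  "store N b blk A W =
     concat (map (\<lambda>n. concat (map (\<lambda>q. take b (drop (q * b) (W n))) (sorted_list_of_set (blk ` A))))
       [1..<Suc N])"

text \<open>
  A term \<open>W\<close> with indices \<open>d\<^sub>v\<close>, \<open>S\<close>, \<open>T\<close> is represented by the triple \<open>(v, S, T)\<close>, a coded message by
  the set of its terms; the terms listed in each of the three cases below are pairwise distinct.
\<close>

type_synonym msg_term = "nat \<times> nat set \<times> nat set"

definition elem_at :: "nat set \<Rightarrow> nat \<Rightarrow> nat" where
  "elem_at I p = sorted_list_of_set I ! (p - 1)"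

definition positions :: "nat set \<Rightarrow> nat set \<Rightarrow> nat set" where
  "positions I A = {p \<in> {1..card I}. elem_at I p \<in> A}"

definition rot :: "nat set \<Rightarrow> nat set \<Rightarrow> nat \<Rightarrow> nat set" where
  "rot I A j = elem_at I ` (\<lambda>p. cyc (card I) (int p + int j)) ` positions I A"

definition exchange_terms :: "nat \<Rightarrow> nat set \<Rightarrow> nat set \<Rightarrow> msg_term set" where
  "exchange_terms u S T = insert (u, S, T) ((\<lambda>t. (t, S, insert u T - {t})) ` T)"

definition rot_term :: "nat \<Rightarrow> nat set \<Rightarrow> nat set \<Rightarrow> nat \<Rightarrow> msg_term" where
  "rot_term u S T j =
     (let I = insert u (S \<union> T) in (the_elem (rot I {u} j), rot I S j, rot I T j))"

definition coded_msg :: "nat \<Rightarrow> nat \<Rightarrow> nat \<Rightarrow> nat \<Rightarrow> nat set \<Rightarrow> nat set \<Rightarrow> msg_term set" where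
  "coded_msg K m gp u S T =
     (let I = insert u (S \<union> T); C = {A \<in> index_sets K m. A \<subseteq> I} in
      if C = {S} then exchange_terms u S T
      else if C = {S, insert u T} then
        (let j = (SOME j. j \<in> {1..2 * m - 1} \<and> rot I S j = insert u T);
             (u', S', T') = rot_term u S T j
         in exchange_terms u S T \<union> exchange_terms u' S' T')
      else insert (u, S, T)
        {rot_term u S T i | i. i \<in> {1..m + gp} \<and> rot I S i \<in> index_sets K m})"

definition wanted :: "nat \<Rightarrow> nat \<Rightarrow> nat \<Rightarrow> nat \<Rightarrow> (nat set \<times> nat set) set" where
  "wanted K m gp u =
     {(S, T). S \<in> index_sets K m \<and> u \<notin> S \<and> T \<subseteq> {1..K} - (S \<union> {u}) \<and> card T = gp}"

text \<open>
  \<open>delivers K m gp u D Ms\<close>: starting with user \<open>u\<close> and the outstanding pairs \<open>D\<close>, the delivery loop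
  can complete by sending the list \<open>Ms\<close> of coded messages.
\<close>

inductive delivers ::
    "nat \<Rightarrow> nat \<Rightarrow> nat \<Rightarrow> nat \<Rightarrow> (nat \<Rightarrow> (nat set \<times> nat set) set) \<Rightarrow> msg_term set list \<Rightarrow> bool"
  for K m gp where
  finished: "K < u \<Longrightarrow> delivers K m gp u D []"
| next_user: "u \<le> K \<Longrightarrow> D u = {} \<Longrightarrow> delivers K m gp (Suc u) D Ms \<Longrightarrow> delivers K m gp u D Ms"
| transmit: "u \<le> K \<Longrightarrow> (S, T) \<in> D u \<Longrightarrow> X = coded_msg K m gp u S T \<Longrightarrow>
    delivers K m gp u (\<lambda>v. D v - {(S', T'). (v, S', T') \<in> X}) Ms \<Longrightarrow>
    delivers K m gp u D (X # Ms)"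

definition delivery_run :: "nat \<Rightarrow> nat \<Rightarrow> nat \<Rightarrow> msg_term set list \<Rightarrow> bool" where
  "delivery_run K m gp Ms \<longleftrightarrow> delivers K m gp 1 (wanted K m gp) Ms"

text \<open>Addition in the field \<open>bit\<close> is XOR.\<close>

definition encode ::
    "nat \<Rightarrow> nat \<Rightarrow> nat \<Rightarrow> (nat \<times> nat set \<Rightarrow> nat) \<Rightarrow> (nat \<Rightarrow> nat) \<Rightarrow> (nat \<Rightarrow> bit list) \<Rightarrow>
     msg_term set \<Rightarrow> bit list" where
  "encode K m b blk d W X =
     map (\<lambda>p. \<Sum>(v, S, T)\<in>X. mini b blk (W (d v)) (subfile_of K m S, T) ! p) [0..<b]"

text \<open>
  \<open>tr d\<close> is the list of coded messages sent for the demand vector \<open>d\<close>, i.e. it records which of the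
  admissible selections are made during delivery.
\<close>

definition cwmap ::
    "nat \<Rightarrow> nat \<Rightarrow> nat \<Rightarrow> nat \<Rightarrow> nat \<Rightarrow> nat \<Rightarrow> (nat \<times> nat set \<Rightarrow> nat) \<Rightarrow>
     ((nat \<Rightarrow> nat) \<Rightarrow> msg_term set list) \<Rightarrow> coded_scheme" where
  "cwmap K L N ga gp b blk tr =
     \<lparr> acc = (\<lambda>k. store N b blk (acc_labels K L ga gp k)),
       priv = (\<lambda>u. store N b blk (priv_labels K (ga * L) gp u)),
       bcast = (\<lambda>d W. concat (map (encode K (ga * L) b blk d W) (tr d))),
       acc_bits = (\<lambda>k. N * card (acc_labels K L ga gp k) * b),
       priv_bits = (\<lambda>u. N * card (priv_labels K (ga * L) gp u) * b),
       bcast_bits = (\<lambda>d. length (tr d) * b) \<rparr>"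

definition cwmap_rate ::
    "nat \<Rightarrow> nat \<Rightarrow> nat \<Rightarrow> nat \<Rightarrow> nat \<Rightarrow> ((nat \<Rightarrow> nat) \<Rightarrow> msg_term set list) \<Rightarrow> real" where
  "cwmap_rate K L N ga gp tr =
     (MAX d\<in>demands K N. real (length (tr d)) / real (subpacketization K (ga * L) gp))"

text \<open>
  The block numbering \<open>blk\<close> and the delivery lists \<open>tr\<close> are free parameters of the scheme; the
  lemmas \<open>blk_exists\<close> and \<open>delivery_run_exists\<close> below show that admissible choices always exist.
\<close>

lemma coded_msg_self: "(u, S, T) \<in> coded_msg K m gp u S T"
  by (auto simp: coded_msg_def exchange_terms_def Let_def split: prod.splits)

lemma finite_subfiles: "finite (subfiles K m)"
  by (simp add: subfiles_def)

lemma finite_wanted: "finite (wanted K m gp u)"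
proof (rule finite_subset)
  show "wanted K m gp u \<subseteq> index_sets K m \<times> Pow {1..K}"
    by (auto simp: wanted_def)
  show "finite (index_sets K m \<times> Pow {1..K})"
    by (simp add: index_sets_def finite_subfiles)
qed

lemma delivers_exists:
  assumes "\<And>v. finite (D v)"
  shows "\<exists>Ms. delivers K m gp u D Ms"
  using assms
proof (induction "(Suc K - u, card (D u))" arbitrary: u D
    rule: wf_induct_rule[OF wf_lex_prod[OF wf_less_than wf_less_than]])
  case (1 u D)
  show ?case
  proof (cases "K < u")
    case True
    then show ?thesis by (blast intro: finished)
  next
    case False
    show ?thesis
    proof (cases "D u = {}")
      case True
      have "\<exists>Ms. delivers K m gp (Suc u) D Ms"
        by (rule 1) (use False 1(2) in auto)
      then obtain Ms where Ms: "delivers K m gp (Suc u) D Ms" ..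
      have "delivers K m gp u D Ms"
        using False by (intro next_user[where u = u, OF _ True Ms]) simp
      then show ?thesis ..
    next
      case ne: False
      then obtain S T where ST: "(S, T) \<in> D u" by auto
      let ?D = "\<lambda>v. D v - {(S', T'). (v, S', T') \<in> coded_msg K m gp u S T}"
      have "?D u \<subset> D u" using ST coded_msg_self[of u S T K m gp] by blast
      then have "card (?D u) < card (D u)" using 1(2) by (simp add: psubset_card_mono)
      then have "\<exists>Ms. delivers K m gp u ?D Ms"
        by (intro 1) (use 1(2) in auto)
      then obtain Ms where Ms: "delivers K m gp u ?D Ms" ..
      have "delivers K m gp u D (coded_msg K m gp u S T # Ms)"
        using False by (intro transmit[where D = D and u = u, OF _ ST refl Ms]) simp
      then show ?thesis ..
    qed
  qed
qed

lemma delivery_run_exists: "\<exists>Ms. delivery_run K m gp Ms"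
  unfolding delivery_run_def by (rule delivers_exists) (rule finite_wanted)

lemma card_index_set:
  assumes "m \<le> K"
  shows "card (index_set K m i) = m"
proof -
  have "inj_on (cyc K) {int i - int m + 1..int i}"
  proof (rule inj_onI)
    fix x y
    assume xy: "x \<in> {int i - int m + 1..int i}" "y \<in> {int i - int m + 1..int i}"
      and eq: "cyc K x = cyc K y"
    then have K: "0 < K" using assms by auto
    from eq have "nat ((x - 1) mod int K) = nat ((y - 1) mod int K)"
      by (simp add: cyc_def)
    then have "(x - 1) mod int K = (y - 1) mod int K"
      using K by (simp add: eq_nat_nat_iff)
    then have "int K dvd (x - 1) - (y - 1)"
      by (simp add: mod_eq_dvd_iff)
    moreover have "\<bar>(x - 1) - (y - 1)\<bar> < int K" using xy assms by auto
    ultimately show "x = y" using dvd_imp_le_int[of "(x - 1) - (y - 1)" "int K"] by linarith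
  qed
  then show ?thesis by (simp add: index_set_def card_image)
qed

lemma index_set_subset:
  assumes "0 < K"
  shows "index_set K m i \<subseteq> {1..K}"
proof -
  have "cyc K a \<in> {1..K}" for a
  proof -
    have "0 \<le> (a - 1) mod int K" "(a - 1) mod int K < int K" using assms by simp_all
    then show ?thesis unfolding cyc_def by auto
  qed
  then show ?thesis by (auto simp: index_set_def)
qed

lemma card_mini_labels:
  assumes "0 < K" "m \<le> K"
  shows "card (mini_labels K m gp) = subpacketization K m gp"
proof -
  have "card {T. T \<subseteq> {1..K} - index_set K m i \<and> card T = gp} = (K - m) choose gp" for i
  proof -
    have "card ({1..K} - index_set K m i) = K - m"
      using card_index_set[OF assms(2)] index_set_subset[OF assms(1)]
      by (metis card_Diff_subset card_atLeastAtMost diff_Suc_1 finite_atLeastAtMost finite_subset)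
    then show ?thesis by (simp add: n_subsets)
  qed
  moreover have "card (mini_labels K m gp) =
      (\<Sum>i\<in>subfiles K m. card {T. T \<subseteq> {1..K} - index_set K m i \<and> card T = gp})"
    unfolding mini_labels_def by (intro card_SigmaI finite_subfiles ballI) simp
  ultimately show ?thesis
    by (simp add: subfiles_def subpacketization_def)
qed

lemma blk_exists:
  assumes "0 < K" "m \<le> K"
  shows "\<exists>blk. bij_betw blk (mini_labels K m gp) {..<subpacketization K m gp}"
proof (rule finite_same_card_bij)
  show "finite (mini_labels K m gp)"
    unfolding mini_labels_def by (intro finite_SigmaI finite_subfiles) simp
qed (simp_all add: card_mini_labels[OF assms])

end

theory Submission
  imports Defs
begin

text \<open>
  The hypothesis says that \<open>ga * L + gp\<close> is \<open>K\<close> or \<open>K - 1\<close>. In the first case nothing is transmitted.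
  In the second case \<open>I\<close> is always the set of all users, and every message consists of the \<open>K\<close>
  rotations of the selected triple. These orbits partition the wanted mini-subfiles, of which there
  are as many as mini-subfiles per file, so the rate is at most \<open>1 / K\<close>.
  In both cases this is \<open>1 - (Ma * L + Mp) / N\<close>, which bounds the rate of every scheme from below: the
  caches seen by user 1 and the broadcasts for the \<open>N\<close> constant demand vectors determine all files.
\<close>

text \<open>What makes \<open>ga * L + gp = K - 1\<close> tractable is that an index set and a label
  \<open>T\<close> together leave out exactly one user. So each mini-subfile label is wanted by one
  user only, \<open>T\<close> is the complement of \<open>S\<close> and \<open>u\<close>, and a
  triple is given by two residues, the user and the end of the arc, which a rotation translates
  together. This also controls the free choices in the delivery loop: whichever member of an orbit
  is selected, the message is that same orbit, and all its members leave the loop at once. Only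
  upper bounds are proved for the cache sizes and for the number of transmissions; equality of the
  rates follows because the scheme is itself one of those to which the lower bound applies. Decoders
  are never written down: it suffices that two libraries which look the same to a user agree in the
  demanded file.\<close>

declare One_nat_def [simp del]

section \<open>Residues modulo \<open>K\<close> and cyclic arcs\<close>

lemma int_cyc: "0 < K \<Longrightarrow> int (cyc K a) = (a - 1) mod int K + 1"
  by (simp add: cyc_def)

lemma cyc_range: "0 < K \<Longrightarrow> cyc K a \<in> {1..K}"
  using int_cyc[of K a] pos_mod_bound[of "int K" "a - 1"] pos_mod_sign[of "int K" "a - 1"]
  unfolding atLeastAtMost_iff by linarith

lemma cyc_eq_iff:
  assumes "0 < K"
  shows "cyc K a = cyc K b \<longleftrightarrow> (a - b) mod int K = 0"
proof -
  have "cyc K a = cyc K b \<longleftrightarrow> (a - 1) mod int K = (b - 1) mod int K"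
    using int_cyc[OF assms, of a] int_cyc[OF assms, of b] by linarith
  also have "\<dots> \<longleftrightarrow> (a - b) mod int K = 0"
    by (simp add: mod_eq_dvd_iff mod_eq_0_iff_dvd)
  finally show ?thesis .
qed

lemma cyc_id: "u \<in> {1..K} \<Longrightarrow> cyc K (int u) = u"
  by (auto simp: cyc_def of_nat_diff nat_mod_distrib nat_diff_distrib)

lemma cyc_add: "0 < K \<Longrightarrow> cyc K (int (cyc K a) + c) = cyc K (a + c)"
proof -
  assume K: "0 < K"
  have "(int (cyc K a) + c - (a + c)) mod int K = ((a - 1) mod int K - (a - 1)) mod int K"
    by (simp add: int_cyc[OF K] algebra_simps)
  also have "\<dots> = 0" by (simp only: mod_diff_left_eq) simp
  finally show ?thesis by (simp only: cyc_eq_iff[OF K])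
qed

text \<open>
  Index sets with an integer end point, so that rotation becomes addition.
\<close>

definition arc :: "nat \<Rightarrow> nat \<Rightarrow> int \<Rightarrow> nat set" where
  "arc K m x = cyc K ` {x - int m + 1..x}"

lemma index_set_arc: "index_set K m i = arc K m (int i)"
  by (simp add: index_set_def arc_def)

text \<open>The residue \<open>(x - a) mod int K\<close> is the number of steps back from the end
  \<open>x\<close> to \<open>a\<close>, so membership compares this distance with the length of the
  arc.\<close>

lemma cyc_mem_arc_iff:
  assumes "0 < K"
  shows "cyc K a \<in> arc K m x \<longleftrightarrow> (x - a) mod int K < int m"
proof
  assume "cyc K a \<in> arc K m x"
  then obtain y where y: "y \<in> {x - int m + 1..x}" "(a - y) mod int K = 0"
    using assms by (auto simp: arc_def cyc_eq_iff)
  have "(x - a) mod int K = (x - a + (a - y)) mod int K"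
    using y(2) by (metis add.right_neutral mod_add_right_eq)
  also have "\<dots> \<le> x - y" using y(1) assms by (simp add: zmod_le_nonneg_dividend)
  finally show "(x - a) mod int K < int m" using y(1) by simp
next
  assume l: "(x - a) mod int K < int m"
  \<comment> \<open>The integer with the residue of \<open>a\<close> among the last \<open>K\<close>
    integers up to \<open>x\<close>.\<close>
  let ?y = "x - (x - a) mod int K"
  have "(a - ?y) mod int K = ((x - a) mod int K - (x - a)) mod int K"
    by (simp add: algebra_simps)
  then have "(a - ?y) mod int K = 0" by (simp add: mod_simps)
  moreover have "?y \<in> {x - int m + 1..x}" using l assms by simp
  ultimately show "cyc K a \<in> arc K m x"
    unfolding arc_def by (intro image_eqI[of _ _ ?y]) (simp_all add: cyc_eq_iff assms)
qed

lemma mem_arc_iff: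
  "u \<in> {1..K} \<Longrightarrow> u \<in> arc K m x \<longleftrightarrow> (x - int u) mod int K < int m"
  using cyc_mem_arc_iff[of K "int u" m x] cyc_id[of u K] by auto

lemma arc_subset: "0 < K \<Longrightarrow> arc K m x \<subseteq> {1..K}"
  unfolding arc_def using cyc_range by blast

lemma arc_shift: "0 < K \<Longrightarrow> (\<lambda>p. cyc K (int p + c)) ` arc K m x = arc K m (x + c)"
proof -
  assume K: "0 < K"
  have "(\<lambda>p. cyc K (int p + c)) ` arc K m x = cyc K ` (\<lambda>y. y + c) ` {x - int m + 1..x}"
    unfolding arc_def image_image using K by (simp add: cyc_add)
  also have "\<dots> = arc K m (x + c)"
    by (simp add: arc_def image_add_atLeastAtMost' algebra_simps)
  finally show ?thesis .
qed

text \<open>Rotation by \<open>x - y\<close> maps one arc to the other, and as a multiple of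
  \<open>K\<close> it fixes every point.\<close>

lemma arc_cong:
  assumes "0 < K" "cyc K x = cyc K y"
  shows "arc K m x = arc K m y"
proof -
  have "(\<lambda>p. cyc K (int p + (x - y))) ` arc K m y = (\<lambda>p. p) ` arc K m y"
  proof (rule image_cong[OF refl])
    fix p assume "p \<in> arc K m y"
    then have "p \<in> {1..K}" using arc_subset[OF assms(1)] by blast
    then have "cyc K (int p) = p" by (rule cyc_id)
    moreover have "cyc K (int p + (x - y)) = cyc K (int p)"
      using assms by (simp add: cyc_eq_iff)
    ultimately show "cyc K (int p + (x - y)) = p" by simp
  qed
  then show ?thesis using arc_shift[OF assms(1), of "x - y" m y] by simp
qed

lemma cyc_cyc: "0 < K \<Longrightarrow> cyc K (int (cyc K x)) = cyc K x"
  using cyc_add[of K x 0] by simp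

text \<open>The end point is the only point of an arc whose successor lies outside of it.\<close>

lemma arc_inj:
  assumes "0 < m" "m < K" "arc K m x = arc K m y"
  shows "cyc K x = cyc K y"
proof -
  have K: "0 < K" using assms by simp
  have "(x - (x + 1)) mod int K = int K - 1" using K by (simp add: zmod_minus1)
  then have "cyc K x \<in> arc K m x" "cyc K (x + 1) \<notin> arc K m x"
    using assms(1,2) K by (simp_all add: cyc_mem_arc_iff)
  then have r: "(y - x) mod int K < int m" "\<not> (y - (x + 1)) mod int K < int m"
    unfolding assms(3) cyc_mem_arc_iff[OF K] by auto
  \<comment> \<open>Were \<open>x\<close> a positive distance before \<open>y\<close>, then
    \<open>x + 1\<close> would be one step closer to \<open>y\<close> and hence still inside the
    arc.\<close>
  have "(y - x) mod int K = 0"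
  proof (rule ccontr)
    assume "(y - x) mod int K \<noteq> 0"
    then have pos: "0 < (y - x) mod int K"
      using pos_mod_sign[of "int K" "y - x"] K by linarith
    have "(y - (x + 1)) mod int K = ((y - x) mod int K - 1) mod int K"
      by (simp add: mod_simps algebra_simps)
    also have "\<dots> = (y - x) mod int K - 1"
      using pos pos_mod_bound[of "int K" "y - x"] K by (intro mod_pos_pos_trivial) linarith+
    finally show False using r by simp
  qed
  then show ?thesis using cyc_eq_iff[OF K, of y x] by simp
qed

text \<open>Integer end points describe the index sets uniformly: for \<open>m = 0\<close> every arc
  is empty, which is the single index set of the unsplit file.\<close>

lemma index_sets_arc:
  assumes "0 < K"
  shows "index_sets K m = range (arc K m)"
proof -
  have "arc K m x \<in> index_sets K m" for x
  proof (cases "m = 0")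
    case True
    then show ?thesis by (simp add: index_sets_def subfiles_def index_set_arc arc_def)
  next
    case False
    have "arc K m x = index_set K m (cyc K x)"
      unfolding index_set_arc by (rule arc_cong) (simp_all add: assms cyc_cyc)
    then show ?thesis
      using False cyc_range[OF assms, of x] by (auto simp: index_sets_def subfiles_def)
  qed
  then show ?thesis by (auto simp: index_sets_def index_set_arc)
qed

text \<open>For \<open>0 < m < K\<close> the arc determines its end; for \<open>m = 0\<close> there
  is only the dummy subfile.\<close>

lemma subfile_of_index_set:
  assumes "m < K" "i \<in> subfiles K m"
  shows "subfile_of K m (index_set K m i) = i"
  unfolding subfile_of_def
proof (rule the_equality)
  show "i \<in> subfiles K m \<and> index_set K m i = index_set K m i" using assms by simp
next
  fix j assume j: "j \<in> subfiles K m \<and> index_set K m j = index_set K m i"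
  show "j = i"
  proof (cases "m = 0")
    case True
    then show ?thesis using j assms by (simp add: subfiles_def)
  next
    case False
    then have "cyc K (int j) = cyc K (int i)"
      using j assms by (intro arc_inj[of m]) (simp_all add: index_set_arc)
    then show ?thesis
      using False j assms by (simp add: subfiles_def cyc_id)
  qed
qed

section \<open>Orbits of terms under rotation\<close>

text \<open>A term in the case \<open>m + gp + 1 = K\<close>, where the label is forced to be
  everything outside the index set and the user. Both residues are kept as integers, so that
  rotating means adding the same integer to both.\<close>

definition shift_term :: "nat \<Rightarrow> nat \<Rightarrow> int \<Rightarrow> int \<Rightarrow> msg_term" where
  "shift_term K m a x = (cyc K a, arc K m x, {1..K} - insert (cyc K a) (arc K m x))"

text \<open>Shifts range over all integers, which makes invariance under rotation a mere reindexing;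
  \<open>orbit_eq_image\<close> recovers the \<open>K\<close> shifts of the delivery.\<close>

definition orbit :: "nat \<Rightarrow> nat \<Rightarrow> int \<Rightarrow> int \<Rightarrow> msg_term set" where
  "orbit K m a x = range (\<lambda>j. shift_term K m (a + j) (x + j))"

lemma shift_term_cong:
  assumes "0 < K" "cyc K a = cyc K a'" "cyc K x = cyc K x'"
  shows "shift_term K m a x = shift_term K m a' x'"
  using arc_cong[OF assms(1,3), of m] assms(2) by (simp add: shift_term_def)

lemma orbit_eq_image:
  assumes "0 < K"
  shows "orbit K m a x = (\<lambda>j. shift_term K m (a + int j) (x + int j)) ` {..<K}"
proof -
  have "shift_term K m (a + j) (x + j) \<in> (\<lambda>j. shift_term K m (a + int j) (x + int j)) ` {..<K}" for j
  proof (rule image_eqI)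
    show "shift_term K m (a + j) (x + j) =
        shift_term K m (a + int (nat (j mod int K))) (x + int (nat (j mod int K)))"
      using assms by (intro shift_term_cong) (simp_all add: cyc_eq_iff mod_simps)
    show "nat (j mod int K) \<in> {..<K}" using assms by (simp add: nat_less_iff)
  qed
  then show ?thesis unfolding orbit_def by auto
qed

lemma fst_orbit:
  assumes "0 < K"
  shows "fst ` orbit K m a x = {1..K}"
proof -
  have "u \<in> fst ` orbit K m a x" if "u \<in> {1..K}" for u
  proof -
    have "u = fst (shift_term K m (a + (int u - a)) (x + (int u - a)))"
      using cyc_id[OF that] by (simp add: shift_term_def)
    then show ?thesis unfolding orbit_def by blast
  qed
  moreover have "fst ` orbit K m a x \<subseteq> {1..K}"
    unfolding orbit_def shift_term_def image_image fst_conv using cyc_range[OF assms] by blast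
  ultimately show ?thesis by blast
qed

lemma finite_orbit: "0 < K \<Longrightarrow> finite (orbit K m a x)"
  by (simp add: orbit_eq_image)

text \<open>There are \<open>K\<close> shifts, and already the users of the terms take all
  \<open>K\<close> values.\<close>

lemma card_orbit:
  assumes "0 < K"
  shows "card (orbit K m a x) = K"
proof (rule antisym)
  show "card (orbit K m a x) \<le> K"
    unfolding orbit_eq_image[OF assms] using card_image_le[of "{..<K}"] by simp
  show "K \<le> card (orbit K m a x)"
    using card_image_le[OF finite_orbit[OF assms], of fst m a x] fst_orbit[OF assms] by simp
qed

text \<open>Needed for decoding: besides its own wanted term, a user meets only terms of other users
  in a message.\<close>

lemma inj_on_fst_orbit: "0 < K \<Longrightarrow> inj_on fst (orbit K m a x)"
  by (intro eq_card_imp_inj_on) (simp_all add: finite_orbit fst_orbit card_orbit)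

lemma orbit_shift: "orbit K m (a + j) (x + j) = orbit K m a x"
proof -
  have "range (\<lambda>i. shift_term K m (a + j + i) (x + j + i)) =
      (\<lambda>i. shift_term K m (a + i) (x + i)) ` range (\<lambda>i. j + i)"
    unfolding image_image by (simp only: add.assoc)
  also have "range (\<lambda>i. j + i) = UNIV" by (simp add: surj_plus)
  finally show ?thesis by (simp add: orbit_def)
qed

lemma orbit_cong:
  assumes "0 < K" "cyc K a = cyc K a'"
  shows "orbit K m a x = orbit K m a' x"
proof -
  have "shift_term K m (a + j) (x + j) = shift_term K m (a' + j) (x + j)" for j
    using assms by (intro shift_term_cong) (simp_all add: cyc_eq_iff)
  then show ?thesis by (simp add: orbit_def)
qed

section \<open>Rotation of positions when \<open>I\<close> is the set of all users\<close>

lemma elem_at_full: "p \<in> {1..K} \<Longrightarrow> elem_at {1..K} p = p"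
proof -
  assume p: "p \<in> {1..K}"
  have "sorted_list_of_set {1..K} = [1..<Suc K]"
    by (metis atLeastLessThanSuc_atLeastAtMost sorted_list_of_set_range)
  then show ?thesis using p unfolding elem_at_def by (simp del: upt_Suc)
qed

lemma rot_full:
  assumes "0 < K" "A \<subseteq> {1..K}"
  shows "rot {1..K} A j = (\<lambda>p. cyc K (int p + int j)) ` A"
proof -
  have "positions {1..K} A = A"
    using assms(2) elem_at_full[of _ K] unfolding positions_def card_atLeastAtMost by fastforce
  then show ?thesis
    using elem_at_full[OF cyc_range[OF assms(1)]] by (simp add: rot_def image_image)
qed

lemma rot_arc: "0 < K \<Longrightarrow> rot {1..K} (arc K m x) j = arc K m (x + int j)"
  by (simp add: rot_full arc_subset arc_shift)

lemma inj_on_rot: "0 < K \<Longrightarrow> inj_on (\<lambda>p. cyc K (int p + c)) {1..K}"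
proof (rule inj_onI)
  fix p q assume K: "0 < K" and "p \<in> {1..K}" "q \<in> {1..K}"
    and e: "cyc K (int p + c) = cyc K (int q + c)"
  then have "cyc K (int p) = cyc K (int q)" by (simp add: cyc_eq_iff)
  then show "p = q" using \<open>p \<in> _\<close> \<open>q \<in> _\<close> by (simp add: cyc_id)
qed

text \<open>Rotation permutes \<open>{1..K}\<close>, so the rotated complement is the complement of
  the rotated set.\<close>

lemma rot_term_full:
  assumes K: "0 < K" and u: "u \<in> {1..K}" and T: "T = {1..K} - insert u (arc K m x)"
  shows "rot_term u (arc K m x) T j = shift_term K m (int u + int j) (x + int j)"
proof -
  let ?f = "\<lambda>p. cyc K (int p + int j)"
  have I: "insert u (arc K m x \<union> T) = {1..K}" using T u arc_subset[OF K, of m x] by auto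
  have "?f ` {1..K} = {1..K}"
    using K by (intro endo_inj_surj inj_on_rot) (auto simp del: atLeastAtMost_iff intro: cyc_range)
  moreover have "?f ` T = ?f ` {1..K} - ?f ` insert u (arc K m x)"
    unfolding T using u arc_subset[OF K, of m x] inj_on_rot[OF K]
    by (intro inj_on_image_set_diff[where C = "{1..K}"]) auto
  moreover have "?f ` insert u (arc K m x) = insert (cyc K (int u + int j)) (arc K m (x + int j))"
    using arc_shift[OF K, of "int j" m x] by simp
  ultimately have "rot {1..K} T j =
      {1..K} - insert (cyc K (int u + int j)) (arc K m (x + int j))"
    using rot_full[OF K, of T j] T by simp
  moreover have "rot {1..K} {u} j = {cyc K (int u + int j)}"
    using rot_full[OF K, of "{u}" j] u by simp
  ultimately show ?thesis
    unfolding rot_term_def I Let_def rot_arc[OF K] by (simp add: shift_term_def)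
qed

lemma card_arc: "0 < K \<Longrightarrow> m \<le> K \<Longrightarrow> card (arc K m x) = m"
  using card_index_set[of m K "cyc K x"] arc_cong[of K "int (cyc K x)" x m]
  by (simp add: index_set_arc cyc_cyc)

text \<open>
  Here \<open>I\<close> is the set of all users, so that the three cases of the delivery coincide. The second
  special case arises only for \<open>K = 2\<close>.
\<close>

lemma coded_msg_eq_orbit:
  assumes Kg: "m + gp + 1 = K" and u: "u \<in> {1..K}" "u \<notin> arc K m x"
    and T: "T = {1..K} - insert u (arc K m x)"
  shows "coded_msg K m gp u (arc K m x) T = orbit K m (int u) x"
proof -
  have K: "0 < K" "m < K" using Kg by auto
  let ?S = "arc K m x"
  let ?g = "\<lambda>j. shift_term K m (int u + int j) (x + int j)"
  have I: "insert u (?S \<union> T) = {1..K}" using T u arc_subset[OF K(1), of m x] by auto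
  have C: "{A \<in> index_sets K m. A \<subseteq> {1..K}} = range (arc K m)"
    unfolding index_sets_arc[OF K(1)] using arc_subset[OF K(1)] by blast
  have g0: "?g 0 = (u, ?S, T)" using u T by (simp add: shift_term_def cyc_id)
  have orb: "orbit K m (int u) x = ?g ` {..<K}" by (rule orbit_eq_image[OF K(1)])
  show ?thesis
  proof (cases "m = 0")
    case True
    \<comment> \<open>The only index set is empty, so the first special case applies. With
      \<open>S\<close> empty a term is determined by its user, and both the orbit and the exchange
      terms run over all users.\<close>
    then have S: "arc K m y = {}" for y by (simp add: arc_def)
    have "orbit K m (int u) x = (\<lambda>v. (v, {}, {1..K} - {v})) ` fst ` orbit K m (int u) x"
      unfolding orbit_def image_image shift_term_def S by simp
    also have "\<dots> = (\<lambda>v. (v, {}, {1..K} - {v})) ` insert u T"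
      unfolding fst_orbit[OF K(1)] using u T by (simp add: S insert_absorb)
    also have "\<dots> = exchange_terms u {} T"
      using u unfolding exchange_terms_def T S by (auto simp: insert_absorb)
    finally show ?thesis
      unfolding coded_msg_def I Let_def C unfolding S by simp
  next
    case False
    \<comment> \<open>Neighbouring arcs differ for \<open>0 < m < K\<close>, which rules out the
      first special case.\<close>
    have nS: "arc K m (x + 1) \<noteq> ?S"
    proof
      assume "arc K m (x + 1) = ?S"
      then have "cyc K (x + 1) = cyc K x" using False K by (intro arc_inj[of m]) auto
      then show False using K False by (simp add: cyc_eq_iff)
    qed
    then have n1: "range (arc K m) \<noteq> {?S}" by (metis rangeI singletonD)
    show ?thesis
    proof (cases "range (arc K m) = {?S, insert u T}")
      case True
      \<comment> \<open>The \<open>K\<close> end points give \<open>K\<close> different arcs, but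
        only two are available. This forces \<open>K = 2\<close>, hence \<open>m = 1\<close> and
        \<open>gp = 0\<close>.\<close>
      have "arc K m ` int ` {1..K} \<subseteq> {?S, insert u T}" using True by blast
      moreover have "card (arc K m ` int ` {1..K}) = K"
      proof -
        have "inj_on (arc K m \<circ> int) {1..K}"
        proof (rule inj_onI)
          fix i j assume ij: "i \<in> {1..K}" "j \<in> {1..K}" "(arc K m \<circ> int) i = (arc K m \<circ> int) j"
          then have "cyc K (int i) = cyc K (int j)"
            using False K by (intro arc_inj[of m]) auto
          then show "i = j" using ij by (simp add: cyc_id)
        qed
        then show ?thesis using card_image by (fastforce simp: image_image comp_def)
      qed
      ultimately have "K \<le> card {?S, insert u T}" by (metis card_mono finite.emptyI finite.insertI)
      also have "\<dots> \<le> 2" by (simp add: card_insert_if)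
      finally have K2: "K = 2" "m = 1" "gp = 0" using False Kg by auto
      have "card T = 0"
        using u T card_arc[of K m x] K arc_subset[OF K(1), of m x] K2
        by (simp add: card_Diff_subset finite_subset)
      moreover have "finite T" using T by simp
      ultimately have Te: "T = {}" by simp
      have r1: "rot {1..K} ?S 1 = insert u T"
        using True nS rot_arc[OF K(1), of m x 1] by auto
      \<comment> \<open>With \<open>m = 1\<close> the range \<open>{1..2 * m - 1}\<close> leaves
        only the shift \<open>1\<close>.\<close>
      have j: "(SOME j. j \<in> {1..2 * m - 1} \<and> rot {1..K} ?S j = insert u T) = 1"
        by (rule some_equality) (use K2 r1 in auto)
      obtain u' S' T' where g1: "?g 1 = (u', S', T')" by (cases "?g 1") auto
      have T': "T' = {}"
      proof -
        have "?g 1 = rot_term u ?S T 1" using rot_term_full[OF K(1) u(1) T, of 1] by simp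
        then have "T' = rot {1..K} T 1" using g1 I by (simp add: rot_term_def Let_def)
        then show ?thesis using Te by (simp add: rot_def positions_def)
      qed
      have "coded_msg K m gp u ?S T = exchange_terms u ?S T \<union> exchange_terms u' S' T'"
        unfolding coded_msg_def I Let_def C j rot_term_full[OF K(1) u(1) T] g1
        using True n1 by simp
      also have "\<dots> = {?g 0, ?g 1}" unfolding g0 g1 T' Te by (auto simp: exchange_terms_def)
      also have "\<dots> = ?g ` {..<K}" unfolding K2 by (auto simp: lessThan_nat_numeral lessThan_Suc)
      finally show ?thesis unfolding orb .
    next
      case c: False
      \<comment> \<open>Every rotated arc is again an index set, so all shifts from \<open>1\<close>
        to \<open>m + gp = K - 1\<close> contribute; the selected term is shift
        \<open>0\<close>.\<close>
      have "rot {1..K} ?S i \<in> range (arc K m)" for i using rot_arc[OF K(1)] by simp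
      then have "{rot_term u ?S T i | i. i \<in> {1..m + gp} \<and> rot {1..K} ?S i \<in> index_sets K m} =
          ?g ` {1..m + gp}"
        unfolding rot_term_full[OF K(1) u(1) T] index_sets_arc[OF K(1)] by blast
      then have "coded_msg K m gp u ?S T = insert (?g 0) (?g ` {1..m + gp})"
        unfolding coded_msg_def I Let_def C g0 if_not_P[OF n1] if_not_P[OF c] by simp
      also have "\<dots> = ?g ` insert 0 {1..m + gp}" by simp
      also have "insert 0 {1..m + gp} = {..<K}" using Kg by auto
      finally show ?thesis unfolding orb .
    qed
  qed
qed

text \<open>\<open>T\<close> lies among the \<open>K - m - 1 = gp\<close> users outside
  \<open>S\<close> and \<open>u\<close> and has \<open>gp\<close> elements, so it is all of
  them.\<close>

lemma wanted_full:
  assumes "m + gp + 1 = K" "u \<in> {1..K}" "(S, T) \<in> wanted K m gp u"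
  obtains x where "S = arc K m x" "u \<notin> arc K m x" "T = {1..K} - insert u (arc K m x)"
proof -
  have K: "0 < K" using assms by simp
  obtain x where x: "S = arc K m x" "u \<notin> S" "T \<subseteq> {1..K} - insert u S" "card T = gp"
    using assms(3) index_sets_arc[OF K] by (auto simp: wanted_def)
  have "card ({1..K} - insert u S) = gp"
    using assms x arc_subset[OF K, of m x] card_arc[of K m x]
    by (simp add: card_Diff_subset finite_subset)
  then have "T = {1..K} - insert u S" using x by (intro card_subset_eq) auto
  then show ?thesis using that x by blast
qed

lemma coded_msg_wanted:
  assumes "m + gp + 1 = K" "u \<in> {1..K}" "(S, T) \<in> wanted K m gp u"
  obtains x where "coded_msg K m gp u S T = orbit K m (int u) x" "u \<notin> arc K m x"
proof -
  obtain x where "S = arc K m x" "u \<notin> arc K m x" "T = {1..K} - insert u (arc K m x)"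
    using wanted_full[OF assms] .
  then show ?thesis using that[of x] coded_msg_eq_orbit[OF assms(1,2)] by blast
qed

text \<open>Rotation preserves the distance from the user to the end of the arc, so every term is
  again a wanted one, and restarting from it only shifts the orbit. This makes the orbits the
  classes of a partition.\<close>

lemma orbit_term_props:
  assumes "m + gp + 1 = K" "u \<in> {1..K}" "u \<notin> arc K m x" "(v, S, T) \<in> orbit K m (int u) x"
  shows "v \<in> {1..K}" "(S, T) \<in> wanted K m gp v" "T = {1..K} - insert v S"
    "coded_msg K m gp v S T = orbit K m (int u) x"
proof -
  have K: "0 < K" using assms by simp
  obtain j where j: "v = cyc K (int u + j)" "S = arc K m (x + j)" "T = {1..K} - insert v S"
    using assms(4) by (auto simp: orbit_def shift_term_def)
  show v: "v \<in> {1..K}" and T: "T = {1..K} - insert v S" using j cyc_range[OF K] by auto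
  have vS: "v \<notin> arc K m (x + j)"
    using assms(2,3) unfolding j(1) cyc_mem_arc_iff[OF K] by (simp add: mem_arc_iff)
  have "card T = gp"
    using T v vS assms(1) arc_subset[OF K, of m "x + j"] card_arc[of K m "x + j"] j(2)
    by (simp add: card_Diff_subset finite_subset)
  then show "(S, T) \<in> wanted K m gp v"
    using T vS j(2) index_sets_arc[OF K] by (auto simp: wanted_def)
  have "coded_msg K m gp v S T = orbit K m (int v) (x + j)"
    using coded_msg_eq_orbit[OF assms(1) v vS] j(2) T by simp
  also have "\<dots> = orbit K m (int u + j) (x + j)"
    by (rule orbit_cong[OF K]) (simp add: j(1) cyc_cyc K)
  also have "\<dots> = orbit K m (int u) x" by (rule orbit_shift)
  finally show "coded_msg K m gp v S T = orbit K m (int u) x" .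
qed

section \<open>The delivery loop\<close>

text \<open>The loop passes a user only when nothing is outstanding for that user, and a pair leaves
  the outstanding set only by occurring in a message sent.\<close>

lemma delivers_covers:
  "delivers K m gp u D Ms \<Longrightarrow> v \<in> {u..K} \<Longrightarrow> (S, T) \<in> D v \<Longrightarrow> \<exists>X\<in>set Ms. (v, S, T) \<in> X"
proof (induction rule: delivers.induct)
  case (next_user u D Ms)
  then show ?case by (cases "v = u") auto
qed auto

text \<open>Outstanding sets only shrink, so each selected pair was outstanding from the
  start.\<close>

lemma delivers_msgs:
  "delivers K m gp u D Ms \<Longrightarrow> X \<in> set Ms \<Longrightarrow>
    \<exists>v\<in>{u..K}. \<exists>(S, T)\<in>D v. X = coded_msg K m gp v S T"
proof (induction rule: delivers.induct)
  case (next_user u D Ms)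
  then obtain v where "v \<in> {Suc u..K}" "\<exists>(S, T)\<in>D v. X = coded_msg K m gp v S T" by blast
  then show ?case by (intro bexI[of _ v]) auto
next
  case (transmit u S T D Y Ms)
  show ?case
  proof (cases "X = Y")
    case True
    then show ?thesis using transmit.hyps by (intro bexI[of _ u] bexI[of _ "(S, T)"]) auto
  next
    case False
    then show ?thesis using transmit by fastforce
  qed
qed simp

text \<open>If the possible messages partition the outstanding terms, every transmission uses up a block.\<close>

lemma delivers_length:
  assumes "delivers K m gp u D Ms" "0 < u" "\<And>v. finite (D v)"
    and "\<And>v S T. v \<in> {1..K} \<Longrightarrow> (S, T) \<in> D v \<Longrightarrow> card (coded_msg K m gp v S T) = k"
    and "\<And>v S T. v \<in> {1..K} \<Longrightarrow> (S, T) \<in> D v \<Longrightarrow> coded_msg K m gp v S T \<subseteq> (SIGMA v:{1..K}. D v)"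
    and "\<And>v S T v' S' T'. v \<in> {1..K} \<Longrightarrow> (S, T) \<in> D v \<Longrightarrow> (v', S', T') \<in> coded_msg K m gp v S T \<Longrightarrow>
      coded_msg K m gp v' S' T' = coded_msg K m gp v S T"
  shows "length Ms * k \<le> card (SIGMA v:{1..K}. D v)"
  using assms
proof (induction rule: delivers.induct)
  case (finished u D)
  then show ?case by simp
next
  case (next_user u D Ms)
  show ?case
  proof (rule next_user.IH)
    show "0 < Suc u" by simp
  qed (fact next_user.prems)+
next
  case (transmit u S T D X Ms)
  let ?D = "\<lambda>v. D v - {(S', T'). (v, S', T') \<in> X}"
  have u: "u \<in> {1..K}" using transmit.hyps transmit.prems by simp
  have "length Ms * k \<le> card (SIGMA v:{1..K}. ?D v)"
  proof (rule transmit.IH)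
    fix v S' T'
    assume v: "v \<in> {1..K}" and "(S', T') \<in> ?D v"
    then have D: "(S', T') \<in> D v" and nX: "(v, S', T') \<notin> X" by auto
    show "card (coded_msg K m gp v S' T') = k" by (rule transmit.prems(3)[OF v D])
    show "coded_msg K m gp v S' T' \<subseteq> (SIGMA v:{1..K}. ?D v)"
    proof
      fix t assume t: "t \<in> coded_msg K m gp v S' T'"
      obtain w P Q where [simp]: "t = (w, P, Q)" by (cases t) auto
      \<comment> \<open>Sharing a term with \<open>X\<close> would make this message equal to
        \<open>X\<close>; then its own selected pair would already have been removed.\<close>
      have "(w, P, Q) \<notin> X"
      proof
        assume "(w, P, Q) \<in> X"
        then have "coded_msg K m gp v S' T' = X"
          using transmit.prems(5)[OF v D, of w P Q] transmit.prems(5)[OF u transmit.hyps(2), of w P Q]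
            t transmit.hyps(3) by simp
        then show False using nX coded_msg_self[of v S' T' K m gp] by simp
      qed
      then show "t \<in> (SIGMA v:{1..K}. ?D v)" using transmit.prems(4)[OF v D] t by auto
    qed
    show "coded_msg K m gp v' P Q = coded_msg K m gp v S' T'"
      if "(v', P, Q) \<in> coded_msg K m gp v S' T'" for v' P Q
      by (rule transmit.prems(5)[OF v D that])
  next
    show "0 < u" by (rule transmit.prems(1))
  next
    fix v show "finite (?D v)" using transmit.prems(2) by (rule finite_Diff)
  qed
  moreover have "(SIGMA v:{1..K}. ?D v) = (SIGMA v:{1..K}. D v) - X" by auto
  moreover have X: "X \<subseteq> (SIGMA v:{1..K}. D v)" "card X = k"
    using transmit.prems(3,4)[OF u transmit.hyps(2)] transmit.hyps(3) by auto
  moreover have fin: "finite (SIGMA v:{1..K}. D v)" using transmit.prems(2) by blast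
  moreover have "card X \<le> card (SIGMA v:{1..K}. D v)" using X(1) fin by (rule card_mono[rotated])
  ultimately show ?case using card_Diff_subset[of X] finite_subset by fastforce
qed


section \<open>Files as sequences of blocks, stored blocks and XOR messages\<close>

lemma concat_map_eqD:
  assumes "concat (map f xs) = concat (map g xs)"
    and "\<And>x. x \<in> set xs \<Longrightarrow> length (f x) = length (g x)" and "x \<in> set xs"
  shows "f x = g x"
  using assms by (induction xs) auto

text \<open>A decoder exists as soon as the observation determines the file: it picks any library
  with the given observation.\<close>

lemma factors_through:
  assumes "\<And>W W'. W \<in> A \<Longrightarrow> W' \<in> A \<Longrightarrow> f W = f W' \<Longrightarrow> g W = g W'"
  shows "\<exists>h. \<forall>W\<in>A. h (f W) = g W"
proof (intro exI ballI)
  fix W assume W: "W \<in> A"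
  have "(SOME V. V \<in> A \<and> f V = f W) \<in> A \<and> f (SOME V. V \<in> A \<and> f V = f W) = f W"
    by (rule someI[of _ W]) (simp add: W)
  then show "(\<lambda>y. g (SOME V. V \<in> A \<and> f V = y)) (f W) = g W"
    using assms[of _ W] W by blast
qed

lemma length_block:
  assumes "length w = b * F" "q < F"
  shows "length (take b (drop (q * b) w)) = b"
proof -
  have "(q + 1) * b \<le> F * b" using assms(2) by (intro mult_le_mono) simp_all
  then show ?thesis using assms(1) by (simp add: algebra_simps)
qed

lemma blocks_eqI:
  assumes len: "length w = b * F" "length w' = b * F"
    and eq: "\<And>q. q < F \<Longrightarrow> take b (drop (q * b) w) = take b (drop (q * b) w')"
  shows "w = w'"
proof (rule nth_equalityI)
  fix p assume p: "p < length w"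
  then have b: "0 < b" using len by (cases b) auto
  let ?q = "p div b" and ?r = "p mod b"
  have q: "?q < F" using p len by (simp add: less_mult_imp_div_less mult.commute)
  have r: "?r < b" using b by simp
  have pq: "?q * b + ?r = p" by simp
  have "?q * b \<le> length w" "?q * b \<le> length w'"
    using p len pq by (metis le_add1 less_imp_le order.trans)+
  then have "w ! p = take b (drop (?q * b) w) ! ?r" "w' ! p = take b (drop (?q * b) w') ! ?r"
    using r pq by (simp_all add: nth_drop)
  then show "w ! p = w' ! p" using eq[OF q] by simp
qed (simp add: len)

lemma length_concat_const:
  "(\<And>x. x \<in> set xs \<Longrightarrow> length (f x) = c) \<Longrightarrow> length (concat (map f xs)) = length xs * c"
  by (induction xs) auto

lemma length_store_file:
  assumes "finite A" "blk ` A \<subseteq> {..<F}" "length w = b * F"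
  shows "length (concat (map (\<lambda>q. take b (drop (q * b) w)) (sorted_list_of_set (blk ` A)))) =
    card (blk ` A) * b"
proof -
  have "length (take b (drop (q * b) w)) = b" if "q \<in> set (sorted_list_of_set (blk ` A))" for q
    by (rule length_block[OF assms(3)]) (use that assms in auto)
  then have "length (concat (map (\<lambda>q. take b (drop (q * b) w)) (sorted_list_of_set (blk ` A)))) =
      length (sorted_list_of_set (blk ` A)) * b" by (rule length_concat_const)
  then show ?thesis using assms(1) by simp
qed

lemma length_store:
  assumes "finite A" "blk ` A \<subseteq> {..<F}" "inj_on blk A"
    and "\<And>n. n \<in> {1..N} \<Longrightarrow> length (W n) = b * F"
  shows "length (store N b blk A W) = N * card A * b"
proof -
  have "length (concat (map (\<lambda>q. take b (drop (q * b) (W n))) (sorted_list_of_set (blk ` A)))) =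
      card A * b" if "n \<in> set [1..<Suc N]" for n
  proof -
    have "n \<in> {1..N}" using that by auto
    from length_store_file[OF assms(1,2) assms(4)[OF this]] show ?thesis
      by (simp only: card_image[OF assms(3)])
  qed
  then have "length (store N b blk A W) = length [1..<Suc N] * (card A * b)"
    unfolding store_def by (rule length_concat_const)
  then show ?thesis by simp
qed

text \<open>Stored blocks have lengths independent of the library, so equal contents can be cut into
  equal pieces, by file and then by block number.\<close>

lemma store_eqD:
  assumes "finite A" "blk ` A \<subseteq> {..<F}"
    and "\<And>n. n \<in> {1..N} \<Longrightarrow> length (W n) = b * F"
    and "\<And>n. n \<in> {1..N} \<Longrightarrow> length (W' n) = b * F"
    and "store N b blk A W = store N b blk A W'" "n \<in> {1..N}" "l \<in> A"
  shows "mini b blk (W n) l = mini b blk (W' n) l"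
proof -
  have set_N: "set [1..<Suc N] = {1..N}" by auto
  have "concat (map (\<lambda>q. take b (drop (q * b) (W n))) (sorted_list_of_set (blk ` A))) =
      concat (map (\<lambda>q. take b (drop (q * b) (W' n))) (sorted_list_of_set (blk ` A)))"
    by (rule concat_map_eqD[OF assms(5)[unfolded store_def]], unfold set_N)
      (simp_all only: length_store_file[OF assms(1,2)] assms(3,4,6))
  then have "take b (drop (blk l * b) (W n)) = take b (drop (blk l * b) (W' n))"
  proof (rule concat_map_eqD)
    show "blk l \<in> set (sorted_list_of_set (blk ` A))" using assms(1,7) by simp
  next
    fix q assume "q \<in> set (sorted_list_of_set (blk ` A))"
    then have "q < F" using assms(1,2) by auto
    then show "length (take b (drop (q * b) (W n))) = length (take b (drop (q * b) (W' n)))"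
      by (simp only: length_block[OF assms(3)[OF assms(6)]] length_block[OF assms(4)[OF assms(6)]])
  qed
  then show ?thesis by (simp add: mini_def)
qed

text \<open>A user who knows all terms but one cancels them from the XOR. Knowledge of a term is
  expressed as agreement of the two libraries on it.\<close>

lemma encode_eqD:
  assumes "encode K m b blk d W X = encode K m b blk d W' X" "finite X" "(v, S, T) \<in> X"
    and "\<And>v' S' T'. (v', S', T') \<in> X \<Longrightarrow> (v', S', T') \<noteq> (v, S, T) \<Longrightarrow>
      mini b blk (W (d v')) (subfile_of K m S', T') = mini b blk (W' (d v')) (subfile_of K m S', T')"
    and "length (mini b blk (W (d v)) (subfile_of K m S, T)) = b"
    and "length (mini b blk (W' (d v)) (subfile_of K m S, T)) = b"
  shows "mini b blk (W (d v)) (subfile_of K m S, T) = mini b blk (W' (d v)) (subfile_of K m S, T)"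
proof (rule nth_equalityI)
  fix p assume "p < length (mini b blk (W (d v)) (subfile_of K m S, T))"
  then have p: "p < b" using assms(5) by simp
  let ?f = "\<lambda>W (v, S, T). mini b blk (W (d v)) (subfile_of K m S, T) ! p"
  have "encode K m b blk d W X ! p = encode K m b blk d W' X ! p" using assms(1) by simp
  then have "sum (?f W) X = sum (?f W') X" using p by (simp add: encode_def)
  moreover have "sum (?f W) (X - {(v, S, T)}) = sum (?f W') (X - {(v, S, T)})"
  proof (rule sum.cong[OF refl])
    fix t assume "t \<in> X - {(v, S, T)}"
    then show "?f W t = ?f W' t"
      using assms(4)[of "fst t" "fst (snd t)" "snd (snd t)"] by (simp add: case_prod_beta)
  qed
  ultimately have "?f W (v, S, T) = ?f W' (v, S, T)"
    unfolding sum.remove[OF assms(2,3)] by (simp only: add_right_cancel)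
  then show "mini b blk (W (d v)) (subfile_of K m S, T) ! p =
      mini b blk (W' (d v)) (subfile_of K m S, T) ! p" by simp
qed (simp add: assms(5,6))

section \<open>Sizes of the cache contents\<close>

lemma finite_mini_labels: "finite (mini_labels K m gp)"
  unfolding mini_labels_def by (intro finite_SigmaI finite_subfiles) simp

lemma priv_labels_subset: "priv_labels K m gp u \<subseteq> mini_labels K m gp"
  by (auto simp: priv_labels_def)

lemma acc_labels_subset: "acc_labels K L ga gp k \<subseteq> mini_labels K (ga * L) gp"
  by (auto simp: acc_labels_def)

lemma card_compl_index_set:
  assumes "0 < K" "m \<le> K"
  shows "card ({1..K} - index_set K m i) = K - m"
  using card_index_set[OF assms(2)] index_set_subset[OF assms(1), of m i]
  by (simp add: card_Diff_subset finite_subset)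

text \<open>A cache holds at most \<open>ga\<close> subfiles of each file. The fraction
  \<open>ga / K\<close> is written without division, and as an upper bound, which is what the
  capacity asks for.\<close>

lemma card_acc_labels:
  assumes "0 < K" "ga * L \<le> K" "1 \<le> L"
  shows "card (acc_labels K L ga gp k) * K \<le> ga * subpacketization K (ga * L) gp"
proof (cases "ga = 0")
  case True
  then show ?thesis by (simp add: acc_labels_def)
next
  case False
  let ?C = "(K - ga * L) choose gp"
  let ?I = "(\<lambda>j. cyc K (int k + (int j - 1) * int L)) ` {1..ga}"
  let ?T = "\<lambda>i. {T. T \<subseteq> {1..K} - index_set K (ga * L) i \<and> card T = gp}"
  have "card (acc_labels K L ga gp k) \<le> card (SIGMA i:?I. ?T i)"
    by (rule card_mono) (auto simp: acc_labels_def mini_labels_def)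
  also have "\<dots> = (\<Sum>i\<in>?I. card (?T i))" by (rule card_SigmaI) auto
  also have "\<dots> = card ?I * ?C"
    using card_compl_index_set[OF assms(1,2)] by (simp add: n_subsets)
  also have "\<dots> \<le> ga * ?C" using card_image_le[of "{1..ga}"] by (intro mult_le_mono1) simp
  finally have "card (acc_labels K L ga gp k) * K \<le> ga * ?C * K" by (rule mult_le_mono1)
  \<comment> \<open>\<open>ga\<close> and \<open>L\<close> are both positive here, so the file
    really is split into \<open>K\<close> subfiles.\<close>
  then show ?thesis using False assms(3) by (simp add: subpacketization_def algebra_simps)
qed

text \<open>A fixed element lies in the fraction \<open>k / n\<close> of the
  \<open>k\<close>-subsets of an \<open>n\<close>-set. The subsets avoiding it are counted by
  absorption, \<open>(n - k) * (n choose k) = n * ((n - 1) choose k)\<close>.\<close>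

lemma card_subsets_containing:
  assumes "finite A" "u \<in> A"
  shows "card A * card {T. T \<subseteq> A \<and> card T = k \<and> u \<in> T} = k * (card A choose k)"
proof -
  let ?n = "card A"
  let ?C = "{T. T \<subseteq> A \<and> card T = k \<and> u \<in> T}"
  have "?n choose k = card {T. T \<subseteq> A \<and> card T = k}" by (simp only: n_subsets[OF assms(1)])
  also have "{T. T \<subseteq> A \<and> card T = k} = ?C \<union> {T. T \<subseteq> A - {u} \<and> card T = k}" by auto
  also have "card (?C \<union> {T. T \<subseteq> A - {u} \<and> card T = k}) =
      card ?C + card {T. T \<subseteq> A - {u} \<and> card T = k}"
    using assms by (intro card_Un_disjoint) auto
  also have "card {T. T \<subseteq> A - {u} \<and> card T = k} = (?n - 1) choose k"
    using assms by (simp add: n_subsets)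
  finally have "?n choose k = card ?C + ((?n - 1) choose k)" .
  then have "?n * (?n choose k) = ?n * card ?C + ?n * ((?n - 1) choose k)"
    by (simp add: distrib_left)
  also have "?n * ((?n - 1) choose k) = (?n - k) * (?n choose k)"
    by (rule binomial_absorb_comp[symmetric])
  finally have *: "?n * (?n choose k) = ?n * card ?C + (?n - k) * (?n choose k)" .
  show ?thesis
  proof (cases "k \<le> ?n")
    case True
    then have "?n * (?n choose k) = k * (?n choose k) + (?n - k) * (?n choose k)"
      by (simp flip: distrib_right)
    then show ?thesis using * by simp
  next
    case False
    then show ?thesis using * by (simp add: binomial_eq_0)
  qed
qed

text \<open>The distance from \<open>u\<close> to the end of the arc is injective in the end, and it
  lies in \<open>{m..<K}\<close> when the arc avoids \<open>u\<close>.\<close>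

lemma card_subfiles_avoiding:
  assumes "u \<in> {1..K}" "0 < m"
  shows "card {i \<in> {1..K}. u \<notin> index_set K m i} \<le> K - m"
proof -
  have K: "0 < K" using assms by simp
  let ?f = "\<lambda>i. nat ((int i - int u) mod int K)"
  have "inj_on ?f {1..K}"
  proof (rule inj_onI)
    fix i j assume ij: "i \<in> {1..K}" "j \<in> {1..K}" "?f i = ?f j"
    then have "(int i - int u) mod int K = (int j - int u) mod int K"
      using K by (simp add: eq_nat_nat_iff)
    then have "cyc K (int i) = cyc K (int j)"
      using cyc_eq_iff[OF K] by (simp add: mod_eq_dvd_iff mod_eq_0_iff_dvd)
    then show "i = j" using ij by (simp add: cyc_id)
  qed
  moreover have "?f ` {i \<in> {1..K}. u \<notin> index_set K m i} \<subseteq> {m..<K}"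
    using K assms(1) by (auto simp: index_set_arc mem_arc_iff nat_less_iff le_nat_iff not_less)
  ultimately have "card {i \<in> {1..K}. u \<notin> index_set K m i} \<le> card {m..<K}"
    by (intro card_inj_on_le[of ?f]) (auto elim: inj_on_subset)
  then show ?thesis by simp
qed

text \<open>For \<open>m < K\<close> a user holds the fraction \<open>gp / (K - m)\<close> of each
  subfile whose index set avoids it; for \<open>0 < m\<close> at most \<open>K - m\<close> of the
  \<open>K\<close> subfiles are of this kind.\<close>

lemma card_priv_labels:
  assumes "u \<in> {1..K}" "m \<le> K"
  shows "card (priv_labels K m gp u) * K \<le> gp * subpacketization K m gp"
proof -
  have K: "0 < K" using assms by simp
  let ?I = "{i \<in> subfiles K m. u \<notin> index_set K m i}"
  let ?T = "\<lambda>i. {T. T \<subseteq> {1..K} - index_set K m i \<and> card T = gp \<and> u \<in> T}"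
  have "card (priv_labels K m gp u) \<le> card (SIGMA i:?I. ?T i)"
    by (rule card_mono) (auto simp: finite_subfiles priv_labels_def mini_labels_def)
  also have "\<dots> = (\<Sum>i\<in>?I. card (?T i))" by (rule card_SigmaI) (auto simp: finite_subfiles)
  finally have "(K - m) * card (priv_labels K m gp u) \<le> (\<Sum>i\<in>?I. (K - m) * card (?T i))"
    by (simp flip: sum_distrib_left)
  also have "\<dots> = (\<Sum>i\<in>?I. gp * ((K - m) choose gp))"
  proof (rule sum.cong[OF refl])
    fix i assume "i \<in> ?I"
    then show "(K - m) * card (?T i) = gp * ((K - m) choose gp)"
      using card_subsets_containing[of "{1..K} - index_set K m i" u gp] assms(1)
        card_compl_index_set[OF K assms(2), of i] by simp
  qed
  finally have le: "(K - m) * card (priv_labels K m gp u) \<le> card ?I * (gp * ((K - m) choose gp))"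
    by simp
  \<comment> \<open>For \<open>m = 0\<close> there is one subfile instead of \<open>K\<close>. For
    \<open>m = K\<close> the factor \<open>K - m\<close> cannot be cancelled, but every index set
    contains \<open>u\<close>, so nothing is stored.\<close>
  consider "m = 0" | "m = K" "0 < m" | "0 < m" "m < K" using assms by linarith
  then show ?thesis
  proof cases
    case 1
    have "card ?I \<le> 1" using 1 by (simp add: subfiles_def card_le_Suc0_iff_eq One_nat_def)
    then have "card ?I * (gp * ((K - m) choose gp)) \<le> 1 * (gp * ((K - m) choose gp))"
      by (rule mult_le_mono1)
    then have "(K - m) * card (priv_labels K m gp u) \<le> gp * ((K - m) choose gp)"
      using le by linarith
    then show ?thesis using 1 by (simp add: subpacketization_def mult.commute)
  next
    case 2
    have "index_set K m i = {1..K}" for i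
      using card_subset_eq[OF _ index_set_subset[OF K, of m i]] card_index_set[of m K i] 2 by simp
    then show ?thesis using assms(1) by (simp add: priv_labels_def)
  next
    case 3
    have "card ?I \<le> K - m" using card_subfiles_avoiding[OF assms(1) 3(1)] 3 by (simp add: subfiles_def)
    then have "(K - m) * card (priv_labels K m gp u) \<le> (K - m) * (gp * ((K - m) choose gp))"
      using le by (meson le_trans mult_le_mono1)
    then have "card (priv_labels K m gp u) \<le> gp * ((K - m) choose gp)" using 3 by simp
    then have "card (priv_labels K m gp u) * K \<le> gp * ((K - m) choose gp) * K"
      by (rule mult_le_mono1)
    then show ?thesis using 3 by (simp add: subpacketization_def algebra_simps)
  qed
qed

text \<open>Combines \<open>c / F \<le> g / K\<close> with \<open>g / K = M / N\<close>, cleared of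
  denominators: \<open>c\<close> of the \<open>F\<close> blocks of each file are stored.\<close>

lemma cache_size_le:
  fixes M :: real and K N g c b F :: nat
  assumes "c * K \<le> g * F" "0 < K" "real N * real g = real K * M"
  shows "real (N * c * b) \<le> M * real (b * F)"
proof -
  have "N * b * (c * K) \<le> N * b * (g * F)" using assms(1) by (rule mult_le_mono2)
  then have "real (N * b * (c * K)) \<le> real (N * b * (g * F))" by (rule of_nat_mono)
  also have "\<dots> = real K * (M * real (b * F))" using assms(3) by simp
  finally have "real K * real (N * c * b) \<le> real K * (M * real (b * F))" by (simp add: ac_simps)
  then show ?thesis using assms(2) by simp
qed

section \<open>What a user can read and how much is sent\<close>

text \<open>The end \<open>i\<close> of the arc is \<open>s < ga * L\<close> steps ahead of
  \<open>u\<close>. Dividing \<open>s\<close> by \<open>L\<close> locates the subfile: the remainder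
  selects one of the \<open>L\<close> caches within reach, the quotient plus one is the index
  \<open>j\<close> under which that cache stores it.\<close>

lemma acc_labels_accessible:
  assumes "0 < K" "1 \<le> L" "u \<in> {1..K}"
    and "(i, T) \<in> mini_labels K (ga * L) gp" "u \<in> index_set K (ga * L) i"
  obtains k where "k \<in> accessible K L u" "(i, T) \<in> acc_labels K L ga gp k"
proof -
  have "ga * L \<noteq> 0" using assms(5) by (intro notI) (simp add: index_set_def)
  then have i: "i \<in> {1..K}" using assms(4) by (auto simp: mini_labels_def subfiles_def)
  define s where "s = nat ((int i - int u) mod int K)"
  have s: "int s = (int i - int u) mod int K" using assms(1) by (simp add: s_def)
  have "int s < int (ga * L)" using assms(3,5) s by (simp add: index_set_arc mem_arc_iff)
  then have "s < ga * L" by (simp only: of_nat_less_iff)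
  then have j: "s div L < ga" by (simp add: less_mult_imp_div_less)
  define k where "k = cyc K (int u + int (s mod L))"
  have "cyc K (int k + (int (s div L + 1) - 1) * int L) =
      cyc K (int u + int (s mod L) + (int (s div L + 1) - 1) * int L)"
    unfolding k_def by (rule cyc_add[OF assms(1)])
  also have "int u + int (s mod L) + (int (s div L + 1) - 1) * int L =
      int u + int (s mod L + s div L * L)"
    by (simp only: of_nat_add of_nat_mult of_nat_1) simp
  also have "s mod L + s div L * L = s" by simp
  also have "cyc K (int u + int s) = cyc K (int i)"
  proof -
    have "(int u + int s - int i) mod int K =
        ((int i - int u) mod int K - (int i - int u)) mod int K" by (simp add: s algebra_simps)
    also have "\<dots> = 0" by (simp only: mod_diff_left_eq) simp
    finally show ?thesis by (simp only: cyc_eq_iff[OF assms(1)])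
  qed
  also have "\<dots> = i" by (rule cyc_id[OF i])
  finally have "i = cyc K (int k + (int (s div L + 1) - 1) * int L)" by simp
  then have "(i, T) \<in> acc_labels K L ga gp k"
    unfolding acc_labels_def using assms(4) j by (auto intro!: bexI[of _ "s div L + 1"])
  moreover have "k \<in> accessible K L u"
    unfolding accessible_def k_def using assms(2) by (intro imageI) simp
  ultimately show ?thesis using that by blast
qed

text \<open>\<open>T\<close> misses \<open>u\<close> among the \<open>K - m\<close> users outside
  the index set. Hence for \<open>m + gp = K\<close> no label is hidden from any user.\<close>

lemma mini_labels_avoiding_less:
  assumes "(i, T) \<in> mini_labels K m gp" "u \<in> {1..K}" "u \<notin> index_set K m i" "u \<notin> T" "m \<le> K"
  shows "m + gp < K"
proof -
  have K: "0 < K" using assms(2) by simp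
  have T: "T \<subseteq> {1..K} - index_set K m i" "card T = gp" using assms(1) by (auto simp: mini_labels_def)
  have "T \<subset> {1..K} - index_set K m i" using T(1) assms(2-4) by blast
  then have "card T < card ({1..K} - index_set K m i)" by (intro psubset_card_mono) auto
  then show ?thesis using T(2) card_compl_index_set[OF K assms(5), of i] by simp
qed

lemma wanted_mini_labels:
  assumes "0 < K" "m < K" "(S, T) \<in> wanted K m gp u"
  shows "(subfile_of K m S, T) \<in> mini_labels K m gp" "index_set K m (subfile_of K m S) = S"
proof -
  obtain i where i: "i \<in> subfiles K m" "S = index_set K m i"
    using assms(3) by (auto simp: wanted_def index_sets_def)
  then have e: "subfile_of K m S = i" using subfile_of_index_set[OF assms(2)] by simp
  show "index_set K m (subfile_of K m S) = S" using e i(2) by simp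
  show "(subfile_of K m S, T) \<in> mini_labels K m gp"
    unfolding e using assms(3) i by (auto simp: mini_labels_def wanted_def)
qed

text \<open>The factor \<open>K - (m + gp)\<close> is \<open>0\<close> or \<open>1\<close>, so one
  inequality serves both cases.\<close>

lemma delivery_run_length:
  assumes "delivery_run K m gp Ms" "0 < K" "K \<le> m + gp + 1" "m + gp \<le> K"
  shows "length Ms * K \<le> (K - (m + gp)) * subpacketization K m gp"
proof -
  have run: "delivers K m gp 1 (wanted K m gp) Ms" using assms(1) by (simp add: delivery_run_def)
  consider "m + gp = K" | "m + gp + 1 = K" using assms(3,4) by linarith
  then show ?thesis
  proof cases
    case 1
    have False if X: "X \<in> set Ms" for X
    proof -
      obtain u S T where u: "u \<in> {1..K}" and ST: "(S, T) \<in> wanted K m gp u"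
        using delivers_msgs[OF run X] by blast
      obtain i where i: "i \<in> subfiles K m" "S = index_set K m i"
        using ST by (auto simp: wanted_def index_sets_def)
      have "(i, T) \<in> mini_labels K m gp" using ST i by (auto simp: mini_labels_def wanted_def)
      then have "m + gp < K"
        using ST i u 1 by (intro mini_labels_avoiding_less[of i T K m gp u]) (auto simp: wanted_def)
      then show False using 1 by simp
    qed
    then have "Ms = []" by (cases Ms) auto
    then show ?thesis by simp
  next
    case 2
    then have mK: "m < K" by simp
    have "length Ms * K \<le> card (SIGMA v:{1..K}. wanted K m gp v)"
    proof (rule delivers_length[OF run])
      fix v S T assume v: "v \<in> {1..K}" and ST: "(S, T) \<in> wanted K m gp v"
      obtain x where x: "coded_msg K m gp v S T = orbit K m (int v) x" "v \<notin> arc K m x"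
        using coded_msg_wanted[OF 2 v ST] .
      show "card (coded_msg K m gp v S T) = K" unfolding x(1) by (rule card_orbit[OF assms(2)])
      show "coded_msg K m gp v S T \<subseteq> (SIGMA v:{1..K}. wanted K m gp v)"
        unfolding x(1) using orbit_term_props(1,2)[OF 2 v x(2)] by auto
      show "coded_msg K m gp v' S' T' = coded_msg K m gp v S T"
        if "(v', S', T') \<in> coded_msg K m gp v S T" for v' S' T'
        using orbit_term_props(4)[OF 2 v x(2)] that unfolding x(1) by blast
    qed (simp_all add: finite_wanted)
    \<comment> \<open>A label determines its user, the only one outside \<open>S\<close> and
      \<open>T\<close>, so there are at most as many wanted triples as labels.\<close>
    also have "\<dots> \<le> card (mini_labels K m gp)"
    proof (rule card_inj_on_le[of "\<lambda>(v, S, T). (subfile_of K m S, T)"])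
      show "inj_on (\<lambda>(v, S, T). (subfile_of K m S, T)) (SIGMA v:{1..K}. wanted K m gp v)"
      proof (rule inj_onI)
        fix p q
        assume pq: "p \<in> (SIGMA v:{1..K}. wanted K m gp v)" "q \<in> (SIGMA v:{1..K}. wanted K m gp v)"
          and f: "(\<lambda>(v, S, T). (subfile_of K m S, T)) p = (\<lambda>(v, S, T). (subfile_of K m S, T)) q"
        obtain v S T where p: "p = (v, S, T)" by (rule prod_cases3)
        obtain v' S' T' where q: "q = (v', S', T')" by (rule prod_cases3)
        have v: "v \<in> {1..K}" "(S, T) \<in> wanted K m gp v"
          and v': "v' \<in> {1..K}" "(S', T') \<in> wanted K m gp v'"
          and e: "subfile_of K m S = subfile_of K m S'" and TT: "T = T'"
          using pq f by (simp_all add: p q)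
        have SS: "S = S'"
          using wanted_mini_labels(2)[OF assms(2) mK v(2)] wanted_mini_labels(2)[OF assms(2) mK v'(2)]
          unfolding e by (rule trans[OF sym])
        have "v \<notin> S \<and> T = {1..K} - insert v S" by (rule wanted_full[OF 2 v]) simp
        moreover have "v' \<notin> S' \<and> T' = {1..K} - insert v' S'" by (rule wanted_full[OF 2 v']) simp
        ultimately have "v = v'" using v(1) v'(1) SS TT by blast
        then show "p = q" using SS TT by (simp add: p q)
      qed
      show "(\<lambda>(v, S, T). (subfile_of K m S, T)) ` (SIGMA v:{1..K}. wanted K m gp v)
          \<subseteq> mini_labels K m gp"
        using wanted_mini_labels(1)[OF assms(2) mK] by auto
    qed (rule finite_mini_labels)
    also have "\<dots> = subpacketization K m gp" using 2 by (intro card_mini_labels) simp_all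
    finally have "length Ms * K \<le> subpacketization K m gp" .
    moreover have "K - (m + gp) = 1" using 2 by simp
    ultimately show ?thesis by simp
  qed
qed

lemma length_mini:
  assumes "bij_betw blk (mini_labels K m gp) {..<F}" "l \<in> mini_labels K m gp"
    and "length w = b * F"
  shows "length (mini b blk w l) = b"
  unfolding mini_def using assms by (intro length_block[OF assms(3)]) (auto simp: bij_betw_def)

text \<open>
  Every foreign term of a coded message is known to the user \<open>u\<close>: since \<open>I\<close> is the set of all
  users, a term meant for another user has \<open>u\<close> in its index set or in its label \<open>T\<close>.
\<close>

lemma decodable:
  assumes K: "0 < K" "1 \<le> L" and m: "m = ga * L" "K \<le> m + gp + 1" "m \<le> K"
    and blk: "bij_betw blk (mini_labels K m gp) {..<F}"
    and run: "delivery_run K m gp Ms"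
    and d: "d \<in> demands K N" and u: "u \<in> {1..K}"
    and W: "W \<in> libraries N (b * F)" "W' \<in> libraries N (b * F)"
    and bc: "concat (map (encode K m b blk d W) Ms) = concat (map (encode K m b blk d W') Ms)"
    and pr: "store N b blk (priv_labels K m gp u) W = store N b blk (priv_labels K m gp u) W'"
    and ac: "\<And>k. k \<in> accessible K L u \<Longrightarrow>
      store N b blk (acc_labels K L ga gp k) W = store N b blk (acc_labels K L ga gp k) W'"
  shows "W (d u) = W' (d u)"
proof -
  have len: "length (W n) = b * F" "length (W' n) = b * F" if "n \<in> {1..N}" for n
    using W that by (auto simp: libraries_def)
  have dN: "d v \<in> {1..N}" if "v \<in> {1..K}" for v using d that by (auto simp: demands_def)
  have stored: "mini b blk (W n) l = mini b blk (W' n) l"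
    if "store N b blk A W = store N b blk A W'" "A \<subseteq> mini_labels K m gp" "l \<in> A" "n \<in> {1..N}"
    for A l n
  proof (rule store_eqD[of A blk F N W b W', OF _ _ len that(1,4,3)])
    show "finite A" using that(2) finite_mini_labels by (rule finite_subset)
    show "blk ` A \<subseteq> {..<F}" using blk that(2) by (auto simp: bij_betw_def)
  qed
  \<comment> \<open>Readable without the broadcast: from an access cache if \<open>u\<close> is in
    the index set, otherwise from the private cache.\<close>
  have known: "mini b blk (W n) (i, T) = mini b blk (W' n) (i, T)"
    if l: "(i, T) \<in> mini_labels K m gp" "u \<in> index_set K m i \<union> T" and n: "n \<in> {1..N}" for n i T
  proof (cases "u \<in> index_set K m i")
    case True
    obtain k where k: "k \<in> accessible K L u" "(i, T) \<in> acc_labels K L ga gp k"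
      using acc_labels_accessible[OF K u] l(1) True unfolding m(1) by metis
    show ?thesis
      using stored[OF ac[OF k(1)] _ k(2) n] acc_labels_subset[of K L ga gp k] m(1) by simp
  next
    case False
    then have "(i, T) \<in> priv_labels K m gp u" using l by (auto simp: priv_labels_def)
    then show ?thesis using stored[OF pr priv_labels_subset _ n] by blast
  qed
  show ?thesis
  proof (rule blocks_eqI[OF len[OF dN[OF u]]])
    fix q assume "q < F"
    then obtain i T where l: "(i, T) \<in> mini_labels K m gp" "blk (i, T) = q"
      using blk unfolding bij_betw_def by (metis imageE lessThan_iff surj_pair)
    have "mini b blk (W (d u)) (i, T) = mini b blk (W' (d u)) (i, T)"
    proof (cases "u \<in> index_set K m i \<union> T")
      case True
      then show ?thesis using known[OF l(1) _ dN[OF u]] by blast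
    next
      case False
      \<comment> \<open>A block that \<open>u\<close> does not hold exists only when
        \<open>m + gp = K - 1\<close>; otherwise the caches give the whole file.\<close>
      then have mK: "m + gp + 1 = K"
        using mini_labels_avoiding_less[OF l(1) u] m(2,3) by simp
      then have mlt: "m < K" by simp
      let ?S = "index_set K m i"
      have i: "i \<in> subfiles K m" and ST: "(?S, T) \<in> wanted K m gp u"
        using l(1) False by (auto simp: mini_labels_def wanted_def index_sets_def)
      have sub: "subfile_of K m ?S = i" by (rule subfile_of_index_set[OF mlt i])
      have del: "delivers K m gp 1 (wanted K m gp) Ms" using run by (simp add: delivery_run_def)
      obtain X where X: "X \<in> set Ms" "(u, ?S, T) \<in> X"
        using delivers_covers[OF del u ST] by blast
      obtain v S' T' where v: "v \<in> {1..K}" "(S', T') \<in> wanted K m gp v"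
        and Xv: "X = coded_msg K m gp v S' T'"
        using delivers_msgs[OF del X(1)] by blast
      obtain x where x: "X = orbit K m (int v) x" "v \<notin> arc K m x"
        using coded_msg_wanted[OF mK v] unfolding Xv .
      have "encode K m b blk d W X = encode K m b blk d W' X"
        using concat_map_eqD[OF bc _ X(1)] by (simp add: encode_def)
      then have "mini b blk (W (d u)) (subfile_of K m ?S, T) =
          mini b blk (W' (d u)) (subfile_of K m ?S, T)"
      proof (rule encode_eqD[OF _ _ X(2)])
        show "finite X" unfolding x(1) by (rule finite_orbit[OF K(1)])
      next
        fix w P Q assume wX: "(w, P, Q) \<in> X" and ne: "(w, P, Q) \<noteq> (u, ?S, T)"
        have "w \<noteq> u"
          using inj_onD[OF inj_on_fst_orbit[OF K(1)], of "(w, P, Q)" "(u, ?S, T)" m "int v" x]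
            wX X(2) ne x(1) by auto
        note wP = orbit_term_props[OF mK v(1) x(2) wX[unfolded x(1)]]
        have "u \<in> P \<union> Q" using wP(3) u \<open>w \<noteq> u\<close> by auto
        then show "mini b blk (W (d w)) (subfile_of K m P, Q) =
            mini b blk (W' (d w)) (subfile_of K m P, Q)"
          using wanted_mini_labels[OF K(1) mlt wP(2)] by (intro known dN wP(1)) simp_all
      next
        show "length (mini b blk (W (d u)) (subfile_of K m ?S, T)) = b"
          "length (mini b blk (W' (d u)) (subfile_of K m ?S, T)) = b"
          unfolding sub using length_mini[OF blk l(1)] len[OF dN[OF u]] by blast+
      qed
      then show ?thesis unfolding sub .
    qed
    then show "take b (drop (q * b) (W (d u))) = take b (drop (q * b) (W' (d u)))"
      unfolding mini_def l(2) .
  qed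
qed

section \<open>Correctness of the scheme\<close>

lemma finite_demands: "finite (demands K N)"
  unfolding demands_def by (intro finite_PiE) auto

lemma const_demand: "n \<in> {1..N} \<Longrightarrow> (\<lambda>u\<in>{1..K}. n) \<in> demands K N"
  by (auto simp: demands_def)

lemma caching_scheme_cwmap:
  fixes Ma Mp :: real
  assumes K: "0 < K" "1 \<le> L" and m: "K \<le> ga * L + gp + 1" "ga * L \<le> K"
    and Ma: "real N * real ga = real K * Ma" and Mp: "real N * real gp = real K * Mp"
    and blk: "bij_betw blk (mini_labels K (ga * L) gp) {..<subpacketization K (ga * L) gp}"
    and run: "\<And>d. d \<in> demands K N \<Longrightarrow> delivery_run K (ga * L) gp (tr d)"
  shows "caching_scheme K L N Ma Mp (b * subpacketization K (ga * L) gp) (cwmap K L N ga gp b blk tr)"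
proof -
  let ?m = "ga * L" and ?s = "cwmap K L N ga gp b blk tr"
  let ?F = "subpacketization K ?m gp"
  have len: "length (store N b blk A W) = N * card A * b"
    if "A \<subseteq> mini_labels K ?m gp" "W \<in> libraries N (b * ?F)" for A W
  proof (rule length_store)
    show "finite A" using that(1) finite_mini_labels by (rule finite_subset)
    show "blk ` A \<subseteq> {..<?F}" "inj_on blk A"
      using blk that(1) by (auto simp: bij_betw_def intro: inj_on_subset)
    show "length (W n) = b * ?F" if "n \<in> {1..N}" for n
      using \<open>W \<in> _\<close> that by (auto simp: libraries_def)
  qed
  have "\<exists>decode. \<forall>W\<in>libraries N (b * ?F).
      decode (bcast ?s d W) (priv ?s u W) (\<lambda>k\<in>accessible K L u. acc ?s k W) = W (d u)"
    if d: "d \<in> demands K N" and u: "u \<in> {1..K}" for d u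
  proof -
    \<comment> \<open>The three sources of the user are bundled into one observation, to which
      \<open>factors_through\<close> applies.\<close>
    let ?view = "\<lambda>W. (bcast ?s d W, priv ?s u W, \<lambda>k\<in>accessible K L u. acc ?s k W)"
    have "\<exists>h. \<forall>W\<in>libraries N (b * ?F). h (?view W) = W (d u)"
    proof (rule factors_through)
      fix W W' assume W: "W \<in> libraries N (b * ?F)" "W' \<in> libraries N (b * ?F)"
        and eq: "?view W = ?view W'"
      show "W (d u) = W' (d u)"
      proof (rule decodable[OF K refl m blk run[OF d] d u W])
        fix k assume k: "k \<in> accessible K L u"
        have "(\<lambda>k\<in>accessible K L u. acc ?s k W) k = (\<lambda>k\<in>accessible K L u. acc ?s k W') k"
          using eq by simp
        then show "store N b blk (acc_labels K L ga gp k) W = store N b blk (acc_labels K L ga gp k) W'"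
          using k by (simp add: cwmap_def)
      qed (use eq in \<open>simp_all add: cwmap_def\<close>)
    qed
    then obtain h where "\<forall>W\<in>libraries N (b * ?F). h (?view W) = W (d u)" ..
    then show ?thesis by (intro exI[of _ "\<lambda>x p a. h (x, p, a)"])
  qed
  moreover have "length (bcast ?s d W) = bcast_bits ?s d" for d W
    by (simp add: cwmap_def encode_def length_concat_const)
  moreover have "length (acc ?s k W) = acc_bits ?s k" if "W \<in> libraries N (b * ?F)" for k W
    using len[OF acc_labels_subset that] by (simp add: cwmap_def)
  moreover have "length (priv ?s u W) = priv_bits ?s u" if "W \<in> libraries N (b * ?F)" for u W
    using len[OF priv_labels_subset that] by (simp add: cwmap_def)
  moreover have "real (acc_bits ?s k) \<le> Ma * real (b * ?F)" for k
    using cache_size_le[OF card_acc_labels[OF K(1) m(2) K(2)] K(1) Ma] by (simp add: cwmap_def)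
  moreover have "real (priv_bits ?s u) \<le> Mp * real (b * ?F)" if "u \<in> {1..K}" for u
    using cache_size_le[OF card_priv_labels[OF that m(2)] K(1) Mp] by (simp add: cwmap_def)
  ultimately show ?thesis unfolding caching_scheme_def by blast
qed

section \<open>Cut-set lower bound\<close>

lemma card_bit_lists: "finite {w :: bit list. length w = n}" "card {w :: bit list. length w = n} = 2 ^ n"
proof -
  have U: "(UNIV :: bit set) = {0, 1}" using bit.exhaust by auto
  have "finite (UNIV :: bit set)" "card (UNIV :: bit set) = 2" unfolding U by simp_all
  then show "finite {w :: bit list. length w = n}" "card {w :: bit list. length w = n} = 2 ^ n"
    using finite_lists_length_eq[of "UNIV :: bit set" n] card_lists_length_eq[of "UNIV :: bit set" n]
    by simp_all
qed

lemma card_libraries: "card (libraries N B) = 2 ^ (B * N)"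
  unfolding libraries_def by (simp add: card_PiE card_bit_lists power_mult)

lemma length_concat_sum:
  "(\<And>x. x \<in> set xs \<Longrightarrow> length (f x) = c x) \<Longrightarrow> length (concat (map f xs)) = (\<Sum>x\<leftarrow>xs. c x)"
  by (induction xs) auto

text \<open>The placement is independent of the demand, so the caches are paid for once, while each
  of the \<open>N\<close> broadcasts costs at most \<open>R * B\<close> bits. Only the number of
  possible strings is counted, so coded placement is covered; dividing by \<open>N * B\<close> gives
  the bound.\<close>

lemma achievable_lower_bound:
  fixes Ma Mp R :: real
  assumes "achievable K L N Ma Mp R" "0 < K" "0 < N" "0 \<le> Ma"
  shows "1 - (Ma * real L + Mp) / real N \<le> R"
proof -
  obtain B s where B: "0 < B" and s: "caching_scheme K L N Ma Mp B s" and R: "worst_rate K N B s = R"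
    using assms(1) by (auto simp: achievable_def)
  let ?d = "\<lambda>n. \<lambda>u\<in>{1..K}. n"
  let ?A = "accessible K L 1"
  have u: "1 \<in> {1..K}" using assms(2) by simp
  have A: "finite ?A" "?A \<subseteq> {1..K}" "card ?A \<le> L"
    using cyc_range[OF assms(2)] card_image_le[of "{0..<L}"]
    by (auto simp: accessible_def simp del: atLeastAtMost_iff)
  have set_A: "set (sorted_list_of_set ?A) = ?A" using A(1) by simp
  have set_N: "set [1..<Suc N] = {1..N}" by auto
  let ?x = "\<lambda>W. concat (map (\<lambda>n. bcast s (?d n) W) [1..<Suc N])"
  let ?z = "\<lambda>W. concat (map (\<lambda>k. acc s k W) (sorted_list_of_set ?A))"
  \<comment> \<open>One string for everything seen. Its parts have lengths independent of the
    library, so it can be cut apart again.\<close>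
  let ?view = "\<lambda>W. ?x W @ priv s 1 W @ ?z W"
  have lb: "length (bcast s (?d n) W) = bcast_bits s (?d n)"
    if "n \<in> {1..N}" "W \<in> libraries N B" for n W
    using s const_demand[OF that(1), of K] that(2) by (auto simp: caching_scheme_def)
  have la: "length (acc s k W) = acc_bits s k" if "k \<in> ?A" "W \<in> libraries N B" for k W
    using s A(2) that by (auto simp: caching_scheme_def)
  have lp: "length (priv s 1 W) = priv_bits s 1" if "W \<in> libraries N B" for W
    using s u that by (auto simp: caching_scheme_def)
  have lx: "length (?x W) = (\<Sum>n\<in>{1..N}. bcast_bits s (?d n))" if "W \<in> libraries N B" for W
  proof -
    have "length (?x W) = (\<Sum>n\<leftarrow>[1..<Suc N]. bcast_bits s (?d n))"
      by (rule length_concat_sum) (use lb that set_N in blast)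
    then show ?thesis by (simp only: sum_list_distinct_conv_sum_set distinct_upt set_N)
  qed
  have lz: "length (?z W) = (\<Sum>k\<in>?A. acc_bits s k)" if "W \<in> libraries N B" for W
  proof -
    have "length (?z W) = (\<Sum>k\<leftarrow>sorted_list_of_set ?A. acc_bits s k)"
      by (rule length_concat_sum) (use la that set_A in blast)
    then show ?thesis by (simp only: sum_list_distinct_conv_sum_set distinct_sorted_list_of_set set_A)
  qed
  define n where "n = (\<Sum>n\<in>{1..N}. bcast_bits s (?d n)) + (priv_bits s 1 + (\<Sum>k\<in>?A. acc_bits s k))"
  have "inj_on ?view (libraries N B)"
  proof (rule inj_onI)
    fix W W' assume W: "W \<in> libraries N B" and W': "W' \<in> libraries N B" and eq: "?view W = ?view W'"
    have x: "?x W = ?x W'" and p: "priv s 1 W = priv s 1 W'" and z: "?z W = ?z W'"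
      using eq lx[OF W] lx[OF W'] lp[OF W] lp[OF W'] by auto
    have acc_eq: "acc s k W = acc s k W'" if "k \<in> ?A" for k
      by (rule concat_map_eqD[OF z]) (use la W W' set_A that in auto)
    have "W k = W' k" if k: "k \<in> {1..N}" for k
    proof -
      have bk: "bcast s (?d k) W = bcast s (?d k) W'"
        by (rule concat_map_eqD[OF x], unfold set_N) (use lb W W' k in auto)
      obtain decode where dec: "\<And>W. W \<in> libraries N B \<Longrightarrow>
          decode (bcast s (?d k) W) (priv s 1 W) (\<lambda>k\<in>?A. acc s k W) = W (?d k 1)"
        using s const_demand[OF k, of K] u unfolding caching_scheme_def by blast
      have "(\<lambda>k\<in>?A. acc s k W) = (\<lambda>k\<in>?A. acc s k W')"
        using acc_eq by (rule restrict_ext)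
      then have "W (?d k 1) = W' (?d k 1)" using dec[OF W] dec[OF W'] bk p by simp
      then show ?thesis using u by simp
    qed
    then show "W = W'" using W W' unfolding libraries_def by (rule PiE_ext[rotated 2])
  qed
  moreover have "?view ` libraries N B \<subseteq> {w. length w = n}"
    using lx lp lz by (auto simp: n_def)
  ultimately have "card (libraries N B) \<le> card {w :: bit list. length w = n}"
    using card_bit_lists(1) by (rule card_inj_on_le)
  \<comment> \<open>\<open>2 ^ (B * N)\<close> libraries inject into \<open>2 ^ n\<close>
    strings.\<close>
  then have BN: "B * N \<le> n" by (simp add: card_libraries card_bit_lists)
  have bR: "real (bcast_bits s (?d k)) \<le> R * real B" if "k \<in> {1..N}" for k
  proof -
    have "real (bcast_bits s (?d k)) / real B \<le> R"
      unfolding R[symmetric] worst_rate_def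
      by (rule Max_ge) (auto simp: finite_demands intro!: imageI const_demand[OF that])
    then show ?thesis using B by (simp add: field_simps)
  qed
  have aM: "real (acc_bits s k) \<le> Ma * real B" if "k \<in> ?A" for k
    using s A(2) that by (auto simp: caching_scheme_def)
  have "real B * real N \<le> real n" using BN by (simp flip: of_nat_mult)
  also have "\<dots> = (\<Sum>n\<in>{1..N}. real (bcast_bits s (?d n))) +
      (real (priv_bits s 1) + (\<Sum>k\<in>?A. real (acc_bits s k)))" by (simp add: n_def)
  also have "\<dots> \<le> real N * (R * real B) + (Mp * real B + real (card ?A) * (Ma * real B))"
  proof (intro add_mono)
    show "(\<Sum>n\<in>{1..N}. real (bcast_bits s (?d n))) \<le> real N * (R * real B)"
      using sum_bounded_above[of "{1..N}" "\<lambda>n. real (bcast_bits s (?d n))", OF bR] by simp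
    show "real (priv_bits s 1) \<le> Mp * real B" using s u by (auto simp: caching_scheme_def)
    show "(\<Sum>k\<in>?A. real (acc_bits s k)) \<le> real (card ?A) * (Ma * real B)"
      using sum_bounded_above[of ?A "\<lambda>k. real (acc_bits s k)", OF aM] by simp
  qed
  \<comment> \<open>There are at most \<open>L\<close> caches within reach; replacing their number
    by \<open>L\<close> uses \<open>0 \<le> Ma\<close>.\<close>
  also have "\<dots> \<le> real N * (R * real B) + (Mp * real B + real L * (Ma * real B))"
    using A(3) assms(4) by (intro add_left_mono mult_right_mono) simp_all
  also have "\<dots> = (real N * R + Mp + real L * Ma) * real B" by (simp add: algebra_simps)
  finally have "real N * real B \<le> (real N * R + Mp + real L * Ma) * real B"
    by (simp add: mult.commute)
  then have "real N \<le> real N * R + Mp + real L * Ma" using B by simp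
  then show ?thesis using assms(3) by (simp add: field_simps)
qed

section \<open>The attained rate against the lower bound\<close>

theorem lemma1:
  fixes K L N ga gp b B :: nat
    and Ma Mp :: real
    and blk :: "nat \<times> nat set \<Rightarrow> nat"
    and tr :: "(nat \<Rightarrow> nat) \<Rightarrow> msg_term set list"
  assumes "1 \<le> L" and "L \<le> K" and "K \<le> N"
    and "0 \<le> Ma" and "Ma \<le> real N" and "0 \<le> Mp" and "Mp \<le> real N"
    and "real ga = real K * Ma / real N"
    and "real gp = real K * Mp / real N"
    and "real N * (1 - 1 / real K) \<le> Ma * real L + Mp"
    and "Ma * real L + Mp \<le> real N"
    and "0 < B" and "B = b * subpacketization K (ga * L) gp"
    and "bij_betw blk (mini_labels K (ga * L) gp) {..<subpacketization K (ga * L) gp}"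
    and "\<And>d. d \<in> demands K N \<Longrightarrow> delivery_run K (ga * L) gp (tr d)"
  shows "caching_scheme K L N Ma Mp B (cwmap K L N ga gp b blk tr)
    \<and> worst_rate K N B (cwmap K L N ga gp b blk tr) = cwmap_rate K L N ga gp tr
    \<and> cwmap_rate K L N ga gp tr = opt_rate K L N Ma Mp"
proof -
  let ?s = "cwmap K L N ga gp b blk tr" and ?F = "subpacketization K (ga * L) gp"
  have K: "0 < K" and N: "0 < N" using assms(1-3) by simp_all
  have Ma: "real N * real ga = real K * Ma" and Mp: "real N * real gp = real K * Mp"
    using assms(8,9) N by simp_all
  have "real N * real (ga * L + gp) = (real N * real ga) * real L + real N * real gp"
    by (simp add: algebra_simps)
  \<comment> \<open>Turns the two bounds on the memory, multiplied by \<open>K\<close>, into bounds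
    on \<open>N\<close> times the integer \<open>ga * L + gp\<close>.\<close>
  then have sum: "real K * (Ma * real L + Mp) = real N * real (ga * L + gp)"
    unfolding Ma Mp by (simp add: algebra_simps)
  have "real N * (real K - 1) = real K * (real N * (1 - 1 / real K))"
    using K by (simp add: field_simps)
  also have "\<dots> \<le> real K * (Ma * real L + Mp)" using assms(10) by (intro mult_left_mono) simp_all
  finally have "real N * (real K - 1) \<le> real N * real (ga * L + gp)" unfolding sum .
  then have "real K \<le> real (ga * L + gp + 1)" using N by simp
  then have lo: "K \<le> ga * L + gp + 1" by (simp only: of_nat_le_iff)
  have "real K * (Ma * real L + Mp) \<le> real K * real N"
    using assms(11) by (intro mult_left_mono) simp_all
  then have "real N * real (ga * L + gp) \<le> real N * real K" unfolding sum by (simp add: mult.commute)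
  then have "real (ga * L + gp) \<le> real K" using N by simp
  then have hi: "ga * L + gp \<le> K" by (simp only: of_nat_le_iff)
  have b: "0 < b" and F: "0 < ?F" using assms(12,13) by simp_all
  have scheme: "caching_scheme K L N Ma Mp B ?s"
    unfolding assms(13) using hi
    by (intro caching_scheme_cwmap K assms(1) lo Ma Mp assms(14,15)) simp_all
  have rate: "worst_rate K N B ?s = cwmap_rate K L N ga gp tr"
    unfolding worst_rate_def cwmap_rate_def using b by (simp add: assms(13) cwmap_def)
  have ach: "achievable K L N Ma Mp (cwmap_rate K L N ga gp tr)"
    unfolding achievable_def using scheme rate assms(12) by blast
  \<comment> \<open>In terms of the integers the lower bound is \<open>0\<close> or
    \<open>1 / K\<close>, the form in which the transmissions were counted.\<close>
  have bound: "1 - (Ma * real L + Mp) / real N = real (K - (ga * L + gp)) / real K"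
  proof -
    have "(Ma * real L + Mp) / real N = real (ga * L + gp) / real K"
      using sum K N by (simp add: frac_eq_eq mult.commute)
    then show ?thesis using K hi by (simp add: of_nat_diff diff_divide_distrib)
  qed
  have "cwmap_rate K L N ga gp tr \<le> real (K - (ga * L + gp)) / real K"
  proof -
    have "real (length (tr d)) / real ?F \<le> real (K - (ga * L + gp)) / real K"
      if "d \<in> demands K N" for d
    proof -
      have "length (tr d) * K \<le> (K - (ga * L + gp)) * ?F"
        by (rule delivery_run_length[OF assms(15)[OF that] K lo hi])
      then have "real (length (tr d)) * real K \<le> real (K - (ga * L + gp)) * real ?F"
        by (simp only: of_nat_mult[symmetric] of_nat_le_iff)
      then show ?thesis using K F by (simp add: divide_le_eq le_divide_eq mult.commute)
    qed
    moreover have "demands K N \<noteq> {}" using const_demand[of 1 N K] N by auto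
    ultimately show ?thesis unfolding cwmap_rate_def using finite_demands by simp
  qed
  \<comment> \<open>The rate is at most the lower bound common to all schemes. Being achievable
    itself, it is the minimum, and so the infimum is attained.\<close>
  then have min: "cwmap_rate K L N ga gp tr \<le> R" if "achievable K L N Ma Mp R" for R
    using achievable_lower_bound[OF that K N assms(4)] bound by linarith
  have "opt_rate K L N Ma Mp = cwmap_rate K L N ga gp tr"
    unfolding opt_rate_def using ach min by (intro cInf_eq_minimum) auto
  then show ?thesis using scheme rate by simp
qed

end
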